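(* Let $\mathcal{N}_*$ be the set of all odd integers $n\geqslant 1$ that cannot be written in the form $n=p^\alpha+2^a+2^b$ with $p$ a prime, $\alpha\geqslant 1$ an integer, and $a,b\geqslant 0$ integers. Then there exist absolute constants $C>0$, $c>0$ and $x_0$ such that for all real $x\geqslant x_0$, $$ |\mathcal{N}_*\cap[1,x]|\geqslant c\, x\cdot\exp\bigg(-C\log x\cdot\frac{\log\log\log\log x}{\log\log\log x}\bigg). $$
   Context: Here $\log$ denotes the natural logarithm, and $x_0$ is taken large enough that the iterated logarithms $\log\log\log x$ and $\log\log\log\log x$ are defined and positive for $x\geqslant x_0$. The constants $C$, $c$ and $x_0$ do not depend on any parameter. *)

theory Defs
  imports Complex_Main "HOL-Computational_Algebra.Primes"
begin

definition N_star :: "nat set" where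
  "N_star = {n. odd n \<and> n \<ge> 1 \<and>
     \<not> (\<exists>p \<alpha> a b :: nat. prime p \<and> \<alpha> \<ge> 1 \<and> n = p ^ \<alpha> + 2 ^ a + 2 ^ b)}"

end

(* The exceptional integers are found in one residue class modulo W = 2 * prod Q, where Q consists of
   one prime of multiplicative order d of 2 for each d = 2^(s+1) with s < K and for a positive
   (logarithmic) proportion of the odd d <= M.

   The class is chosen to be 0 modulo the primes of order 2^(s+1); as these divide 2^(2^s) + 1, one of
   them divides n - 2^a - 2^b unless 2^K divides b - a (Crocker).  With b = a + 2^K u, the pairs (a, u) form
   a rectangle of size L x T, where 2^L is about x and 2^K about L / T.  The residues modulo the primes
   of odd order m are then chosen greedily: fixing u and a modulo m always removes a proportion
   1 / (T m) of the pairs left, and the sum of 1 / m over the m in use is of order log M, so only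
   L T exp(- c log M / T) pairs survive.

   If n = p^k + 2^a + 2^b with p neither small nor in Q, then (a, b) is a surviving pair and n - 2^a - 2^b
   has no small prime factor outside Q.  Selberg's sieve bounds the number of such n <= x, for each pair, by a constant
   times x / (W L) * prod (1 + 1/p) over Q, and Chebyshev's estimate makes that product a power of log M.
   Taking M about L^(1/8) and T of order log log M makes the exceptions dominate, while W is
   at most 2^(6 L / T). *)

theory Submission
  imports Defs "HOL-Computational_Algebra.Squarefree" "HOL-Number_Theory.Number_Theory"
    "HOL-Analysis.Harmonic_Numbers" "HOL-Real_Asymp.Real_Asymp"
begin

section \<open>Selberg's sieve\<close>

text \<open>The obstacle is that there are about L^2 pairs (a, b), while the sieve gains only one
  factor L per pair. Fixing both a and b modulo the order m of 2 is sure to remove only a share 1 /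
  m^2 of the pairs, and these shares have a convergent sum. Crocker's step leaves at most T
  differences in each direction, so one of them can be fixed outright and only a still has to be
  fixed modulo m. The share becomes 1 / (T m), whose sum grows with M. By itself that step leaves
  about L T pairs, still too many; the covering has to win back T and the power of log M lost by not
  sifting with the primes of Q.

  T is a compromise: the orders 2^(s+1) add up to about L / T and enter W as an exponent, so T
  bounded would make W a power of x, while T large slows the covering.

  A prime of order m exists for nearly all m by Zsigmondy's theorem. Only odd m with the sum of 1 /
  l over primes l dividing m at most 1 / 2 are used: for these a comparison of sizes proves
  existence without cyclotomic polynomials, and they still carry a positive share of the harmonic
  sum.\<close>

lemma Prod_primes_dvd_iff:
  fixes S :: "nat set"
  assumes "finite S" "\<And>p. p \<in> S \<Longrightarrow> prime p"
  shows "\<Prod>S dvd n \<longleftrightarrow> (\<forall>p\<in>S. p dvd n)"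
  using assms
proof (induction S rule: finite_induct)
  case (insert q S)
  have "coprime q (\<Prod>S)"
    using insert by (intro prod_coprime_right) (metis insertI1 insertI2 primes_coprime)
  then have "q * \<Prod>S dvd n \<longleftrightarrow> q dvd n \<and> \<Prod>S dvd n"
    by (meson divides_mult dvd_mult_left dvd_mult_right)
  then show ?case
    using insert by auto
qed auto

lemma inj_on_Prod_primes:
  assumes "finite P" "\<And>p. p \<in> P \<Longrightarrow> prime (p :: nat)"
  shows "inj_on (\<lambda>S. \<Prod>S) (Pow P)"
proof (rule inj_onI)
  fix S R assume *: "S \<in> Pow P" "R \<in> Pow P" "\<Prod>S = \<Prod>R"
  have 1: "x \<in> S" if "R \<subseteq> P" "S \<subseteq> P" "\<Prod>S = \<Prod>R" "x \<in> R" for x S R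
  proof -
    have fin: "finite S" "finite R" using that assms(1) finite_subset by auto
    have "prime x" using that assms by blast
    have "x dvd \<Prod>S" using that fin by auto
    then obtain y where y: "y \<in> S" "x dvd y"
      using prime_dvd_prod_iff[OF fin(1) \<open>prime x\<close>] by auto
    then have "x = y" using \<open>prime x\<close> assms(2) that primes_dvd_imp_eq by blast
    then show ?thesis using y by simp
  qed
  show "S = R"
  proof
    show "S \<subseteq> R" using 1[OF _ _ *(3)[symmetric]] *(1,2) by auto
    show "R \<subseteq> S" using 1[of R S] * by blast
  qed
qed

text \<open>Moebius inversion on the lattice of finite sets: a proper interval has as many members
  of even as of odd size. With squarefree integers encoded as sets of primes,
  \<open>(-1) ^ card S\<close> is the Moebius function of the product.\<close>

lemma sum_alternating_interval:
  fixes R :: "'a set"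
  assumes "finite R"
  shows "(\<Sum>S | Q \<subseteq> S \<and> S \<subseteq> R. (-1) ^ card S) = (if Q = R then (-1) ^ card R else (0::real))"
proof (cases "Q \<subset> R")
  case True
  have "(\<Sum>S\<in>{S. Q \<subseteq> S \<and> S \<subseteq> R}. (-1) ^ card S) = (0::real)"
  proof (rule sum_alternating_cancels)
    show "finite {S. Q \<subseteq> S \<and> S \<subseteq> R}" using assms by (auto intro: finite_subset[of _ "Pow R"])
    show "card {x \<in> {S. Q \<subseteq> S \<and> S \<subseteq> R}. even (card x)} =
      card {x \<in> {S. Q \<subseteq> S \<and> S \<subseteq> R}. odd (card x)}"
      using card_subsupersets_even_odd[OF assms True]
      by (simp add: conj_ac cong: conj_cong)
  qed
  then show ?thesis using True by auto
next
  case False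
  then have "{S. Q \<subseteq> S \<and> S \<subseteq> R} = (if Q = R then {R} else {})" by auto
  then show ?thesis by simp
qed

lemma sum_swap_inner:
  "(\<Sum>x\<in>A. \<Sum>y\<in>B. \<Sum>z\<in>C. h x y z) = (\<Sum>z\<in>C. \<Sum>x\<in>A. \<Sum>y\<in>B. h x y z)"
proof -
  have "(\<Sum>x\<in>A. \<Sum>y\<in>B. \<Sum>z\<in>C. h x y z) = (\<Sum>x\<in>A. \<Sum>z\<in>C. \<Sum>y\<in>B. h x y z)"
    by (intro sum.cong refl sum.swap)
  also have "\<dots> = (\<Sum>z\<in>C. \<Sum>x\<in>A. \<Sum>y\<in>B. h x y z)"
    by (rule sum.swap)
  finally show ?thesis .
qed

text \<open>If \<open>w {} = 1\<close>, the indicator that no prime of \<open>P\<close> divides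
  \<open>f i\<close> is at most the square of the sum of \<open>w S\<close> over those S whose
  product divides \<open>f i\<close>. Expanding the square (lcm becomes union) and applying
  \<open>level\<close> gives X times a quadratic form in \<open>w\<close>, whose constrained minimum
  is 1 / G, plus an error for each pair of sets. At most D sets and the crude bound D for each
  weight give the error D ^ 4.\<close>

lemma selberg_sieve:
  fixes P :: "nat set" and f :: "'i \<Rightarrow> nat" and X :: real and D :: nat
  assumes I: "finite I" and P: "finite P" "\<And>p. p \<in> P \<Longrightarrow> prime p" and D: "D \<ge> 1"
    and level: "\<And>S. S \<subseteq> P \<Longrightarrow> \<bar>real (card {i \<in> I. \<Prod>S dvd f i}) - X / real (\<Prod>S)\<bar> \<le> 1"
  defines "G \<equiv> (\<Sum>S | S \<subseteq> P \<and> \<Prod>S \<le> D. 1 / (\<Prod>p\<in>S. real p - 1))"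
  shows "real (card {i \<in> I. \<forall>p\<in>P. \<not> p dvd f i}) \<le> X / G + real D ^ 4"
proof -
  note [simp del] = of_nat_prod
  define F where "F = {S. S \<subseteq> P \<and> \<Prod>S \<le> D}"
  \<comment> \<open>Euler's totient of the squarefree number with prime set S.\<close>
  define \<phi> where "\<phi> = (\<lambda>S :: nat set. \<Prod>p\<in>S. real p - 1)"
  define H where "H = (\<lambda>S. \<Sum>R | R \<in> F \<and> S \<subseteq> R. 1 / \<phi> R)"
  \<comment> \<open>the minimiser of the quadratic form evaluated in \<open>diag\<close> below, subject to \<open>w {} = 1\<close>\<close>
  define w where "w = (\<lambda>S. (-1) ^ card S * real (\<Prod>S) * H S / G)"
  have finF: "finite F" unfolding F_def using P(1) by (auto intro: finite_subset[of _ "Pow P"])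
  have finS: "finite S" if "S \<in> F" for S
    using that P(1) unfolding F_def by (auto intro: finite_subset)
  have Fprime: "prime p" if "S \<in> F" "p \<in> S" for S p
    using that P(2) unfolding F_def by auto
  have pos: "\<Prod>S > 0" if "S \<subseteq> P" for S
    using that P(2) by (metis prime_gt_0_nat prod_pos subsetD)
  have down: "S \<in> F" if "R \<in> F" "S \<subseteq> R" for S R
  proof -
    have R: "R \<subseteq> P" "\<Prod>R \<le> D" using that unfolding F_def by auto
    have "\<Prod>S dvd \<Prod>R" using finS[OF that(1)] that(2) by (rule prod_dvd_prod_subset)
    then have "\<Prod>S \<le> \<Prod>R" using pos[OF R(1)] by (rule dvd_imp_le)
    then have "\<Prod>S \<le> D" "S \<subseteq> P" using R that(2) by auto
    then show ?thesis unfolding F_def by simp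
  qed
  have \<phi>pos: "\<phi> S > 0" if "S \<in> F" for S
    unfolding \<phi>_def using Fprime[OF that] by (intro prod_pos) (fastforce dest: prime_gt_1_nat)
  have emptyF: "{} \<in> F" using D unfolding F_def by simp
  have Geq: "G = (\<Sum>S\<in>F. 1 / \<phi> S)" unfolding G_def F_def \<phi>_def by simp
  have Gpos: "G > 0" unfolding Geq
    using emptyF finF \<phi>pos by (intro sum_pos) auto
  have H0: "H {} = G" unfolding H_def Geq by simp
  have Hnn: "0 \<le> H S" for S unfolding H_def using \<phi>pos by (intro sum_nonneg) (auto simp: less_imp_le)
  have HG: "H S \<le> G" for S unfolding H_def Geq
    using finF \<phi>pos by (intro sum_mono2) (auto simp: less_imp_le)
  have w0: "w {} = 1" unfolding w_def using H0 Gpos by simp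
  have wabs: "\<bar>w S\<bar> \<le> real D" if "S \<in> F" for S
  proof -
    have "\<bar>w S\<bar> = real (\<Prod>S) * (H S / G)"
      unfolding w_def using Hnn[of S] Gpos by (simp add: abs_mult)
    also have "\<dots> \<le> real (\<Prod>S) * 1"
      using HG[of S] Gpos by (intro mult_left_mono) auto
    also have "\<dots> \<le> real D" using that unfolding F_def by auto
    finally show ?thesis .
  qed
  have cardF: "card F \<le> D"
  proof -
    have "inj_on (\<lambda>S. \<Prod>S) F"
      using inj_on_Prod_primes[OF P] by (rule inj_on_subset) (auto simp: F_def)
    then have "card F = card ((\<lambda>S. \<Prod>S) ` F)" by (simp add: card_image)
    also have "\<dots> \<le> card {1..D}"
      using pos by (intro card_mono) (auto simp: F_def Suc_le_eq)
    finally show ?thesis by simp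
  qed
  \<comment> \<open>Gauss's identity expresses the gcd, the product over S \<inter> R, as the sum of
    \<open>\<phi> Q\<close> over all Q contained in both, and lcm times gcd is the product of the
    two numbers. Hence the form is the diagonal sum of \<open>\<phi> Q * (y Q)^2\<close>.\<close>
  have diag: "(\<Sum>S\<in>F. \<Sum>R\<in>F. w S * w R / real (\<Prod>(S \<union> R))) = 1 / G"
  proof -
    define y where "y = (\<lambda>Q. \<Sum>S | S \<in> F \<and> Q \<subseteq> S. w S / real (\<Prod>S))"
    \<comment> \<open>After inserting \<open>H\<close> and summing over S first, the alternating sum
      over the interval from Q to R leaves only R = Q.\<close>
    have y: "y Q = (-1) ^ card Q / (\<phi> Q * G)" if Q: "Q \<in> F" for Q
    proof -
      have "y Q = (\<Sum>S | S \<in> F \<and> Q \<subseteq> S. \<Sum>R | R \<in> F \<and> S \<subseteq> R. (-1) ^ card S * (1 / \<phi> R / G))"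
        unfolding y_def
      proof (rule sum.cong[OF refl])
        fix S assume "S \<in> {S \<in> F. Q \<subseteq> S}"
        then have "real (\<Prod>S) \<noteq> 0" using pos[of S] unfolding F_def by auto
        then have "w S / real (\<Prod>S) = (-1) ^ card S * (H S / G)"
          unfolding w_def by (simp add: field_simps)
        also have "\<dots> = (\<Sum>R | R \<in> F \<and> S \<subseteq> R. (-1) ^ card S * (1 / \<phi> R / G))"
          unfolding H_def sum_divide_distrib sum_distrib_left ..
        finally show "w S / real (\<Prod>S) = (\<Sum>R | R \<in> F \<and> S \<subseteq> R. (-1) ^ card S * (1 / \<phi> R / G))" .
      qed
      also have "\<dots> = (\<Sum>S\<in>F. \<Sum>R\<in>F. if Q \<subseteq> S \<and> S \<subseteq> R then (-1) ^ card S * (1 / \<phi> R / G) else 0)"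
        using finF by (simp add: sum.inter_filter if_if_eq_conj[symmetric] cong: if_cong)
         (intro sum.cong refl, auto)
      also have "\<dots> = (\<Sum>R\<in>F. \<Sum>S\<in>F. if Q \<subseteq> S \<and> S \<subseteq> R then (-1) ^ card S * (1 / \<phi> R / G) else 0)"
        by (rule sum.swap)
      also have "\<dots> = (\<Sum>R\<in>F. (\<Sum>S | Q \<subseteq> S \<and> S \<subseteq> R. (-1) ^ card S) * (1 / \<phi> R / G))"
      proof (rule sum.cong[OF refl])
        fix R assume "R \<in> F"
        then have "{S \<in> F. Q \<subseteq> S \<and> S \<subseteq> R} = {S. Q \<subseteq> S \<and> S \<subseteq> R}"
          using down by blast
        then show "(\<Sum>S\<in>F. if Q \<subseteq> S \<and> S \<subseteq> R then (-1) ^ card S * (1 / \<phi> R / G) else 0) =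
          (\<Sum>S | Q \<subseteq> S \<and> S \<subseteq> R. (-1) ^ card S) * (1 / \<phi> R / G)"
          using finF by (simp only: sum.inter_filter[symmetric] sum_distrib_right)
      qed
      also have "\<dots> = (\<Sum>R\<in>F. if Q = R then (-1) ^ card R * (1 / \<phi> R / G) else 0)"
        using finS by (intro sum.cong refl) (simp add: sum_alternating_interval)
      also have "\<dots> = (-1) ^ card Q * (1 / \<phi> Q / G)"
        using Q finF by simp
      finally show ?thesis by simp
    qed
    have phi_sum: "1 / real (\<Prod>(S \<union> R)) = (\<Sum>Q | Q \<in> F \<and> Q \<subseteq> S \<and> Q \<subseteq> R. \<phi> Q) / (real (\<Prod>S) * real (\<Prod>R))"
      if "S \<in> F" "R \<in> F" for S R
    proof -
      have fin: "finite S" "finite R" using finS that by auto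
      have "(\<Prod>p\<in>S \<inter> R. (real p - 1) + 1) = (\<Sum>Q\<in>Pow (S \<inter> R). (\<Prod>p\<in>Q. real p - 1) * (\<Prod>p\<in>S \<inter> R - Q. 1))"
        using fin by (intro prod_add) auto
      also have "\<dots> = (\<Sum>Q\<in>Pow (S \<inter> R). \<phi> Q)" unfolding \<phi>_def by simp
      also have "Pow (S \<inter> R) = {Q. Q \<in> F \<and> Q \<subseteq> S \<and> Q \<subseteq> R}"
        using down that by auto
      finally have e: "(\<Sum>Q | Q \<in> F \<and> Q \<subseteq> S \<and> Q \<subseteq> R. \<phi> Q) = real (\<Prod>(S \<inter> R))"
        by (simp add: of_nat_prod)
      have "\<Prod>(S \<union> R) * \<Prod>(S \<inter> R) = \<Prod>S * \<Prod>R"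
        using fin by (rule prod.union_inter)
      then have "real (\<Prod>(S \<union> R)) * real (\<Prod>(S \<inter> R)) = real (\<Prod>S) * real (\<Prod>R)"
        by (metis of_nat_mult)
      moreover have "real (\<Prod>(S \<union> R)) \<noteq> 0" "real (\<Prod>S) \<noteq> 0" "real (\<Prod>R) \<noteq> 0"
        using that pos[of "S \<union> R"] pos[of S] pos[of R] unfolding F_def by auto
      ultimately show ?thesis unfolding e by (simp add: field_simps)
    qed
    have "(\<Sum>S\<in>F. \<Sum>R\<in>F. w S * w R / real (\<Prod>(S \<union> R))) =
      (\<Sum>S\<in>F. \<Sum>R\<in>F. \<Sum>Q\<in>F. if Q \<subseteq> S \<and> Q \<subseteq> R then \<phi> Q * (w S / real (\<Prod>S)) * (w R / real (\<Prod>R)) else 0)"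
    proof (intro sum.cong refl)
      fix S R assume SR: "S \<in> F" "R \<in> F"
      have "w S * w R / real (\<Prod>(S \<union> R)) = w S * w R * (1 / real (\<Prod>(S \<union> R)))" by simp
      also have "\<dots> = (\<Sum>Q | Q \<in> F \<and> Q \<subseteq> S \<and> Q \<subseteq> R. \<phi> Q * (w S / real (\<Prod>S)) * (w R / real (\<Prod>R)))"
        unfolding phi_sum[OF SR] by (simp add: sum_distrib_left sum_divide_distrib mult_ac)
      finally show "w S * w R / real (\<Prod>(S \<union> R)) = (\<Sum>Q\<in>F. if Q \<subseteq> S \<and> Q \<subseteq> R then \<phi> Q * (w S / real (\<Prod>S)) * (w R / real (\<Prod>R)) else 0)"
        using finF by (simp only: sum.inter_filter[symmetric])
    qed
    also have "\<dots> = (\<Sum>Q\<in>F. \<Sum>S\<in>F. \<Sum>R\<in>F. if Q \<subseteq> S \<and> Q \<subseteq> R then \<phi> Q * (w S / real (\<Prod>S)) * (w R / real (\<Prod>R)) else 0)"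
      by (rule sum_swap_inner)
    also have "\<dots> = (\<Sum>Q\<in>F. \<phi> Q * (y Q * y Q))"
    proof (rule sum.cong[OF refl])
      fix Q
      have yy: "y Q = (\<Sum>S\<in>F. if Q \<subseteq> S then w S / real (\<Prod>S) else 0)"
        unfolding y_def using finF by (simp only: sum.inter_filter[symmetric])
      show "(\<Sum>S\<in>F. \<Sum>R\<in>F. if Q \<subseteq> S \<and> Q \<subseteq> R then \<phi> Q * (w S / real (\<Prod>S)) * (w R / real (\<Prod>R)) else 0) = \<phi> Q * (y Q * y Q)"
        unfolding yy sum_product by (simp only: sum_distrib_left, intro sum.cong refl, simp)
    qed
    also have "\<dots> = (\<Sum>Q\<in>F. 1 / \<phi> Q / G\<^sup>2)"
    proof (rule sum.cong[OF refl])
      fix Q assume Q: "Q \<in> F"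
      have "\<phi> Q \<noteq> 0" using \<phi>pos[OF Q] by simp
      then show "\<phi> Q * (y Q * y Q) = 1 / \<phi> Q / G\<^sup>2"
        unfolding y[OF Q] using Gpos
        by (simp add: field_simps power2_eq_square flip: power_add)
    qed
    also have "\<dots> = 1 / G"
      using Gpos unfolding sum_divide_distrib[symmetric] Geq[symmetric] by (simp add: power2_eq_square)
    finally show ?thesis .
  qed
  have "real (card {i \<in> I. \<forall>p\<in>P. \<not> p dvd f i}) = (\<Sum>i\<in>I. if \<forall>p\<in>P. \<not> p dvd f i then 1 else 0)"
    using I by (simp add: sum.inter_filter[symmetric])
  also have "\<dots> \<le> (\<Sum>i\<in>I. (\<Sum>S\<in>F. if \<Prod>S dvd f i then w S else 0)\<^sup>2)"
  proof (rule sum_mono)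
    fix i
    show "(if \<forall>p\<in>P. \<not> p dvd f i then 1 else 0) \<le> (\<Sum>S\<in>F. if \<Prod>S dvd f i then w S else 0)\<^sup>2"
    proof (cases "\<forall>p\<in>P. \<not> p dvd f i")
      case True
      have "{S \<in> F. \<Prod>S dvd f i} = {{}}"
      proof -
        have "S = {}" if "S \<in> F" "\<Prod>S dvd f i" for S
          using that Prod_primes_dvd_iff[OF finS[OF that(1)] Fprime[OF that(1)], of "f i"] True
          unfolding F_def by auto
        then show ?thesis using emptyF by auto
      qed
      then have "(\<Sum>S\<in>F. if \<Prod>S dvd f i then w S else 0) = 1"
        using finF w0 by (simp add: sum.inter_filter[symmetric])
      then show ?thesis by simp
    next
      case False
      then show ?thesis by (simp only: if_False zero_le_power2)
    qed
  qed
  also have "\<dots> = (\<Sum>i\<in>I. \<Sum>S\<in>F. \<Sum>R\<in>F. w S * w R * (if \<Prod>(S \<union> R) dvd f i then 1 else 0))"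
  proof (rule sum.cong[OF refl])
    fix i
    have "(if \<Prod>S dvd f i then w S else 0) * (if \<Prod>R dvd f i then w R else 0) =
      w S * w R * (if \<Prod>(S \<union> R) dvd f i then 1 else 0)" if "S \<in> F" "R \<in> F" for S R
    proof -
      have "\<Prod>(S \<union> R) dvd f i \<longleftrightarrow> (\<forall>p\<in>S \<union> R. p dvd f i)"
        by (rule Prod_primes_dvd_iff) (use that finS Fprime in auto)
      then have "\<Prod>(S \<union> R) dvd f i \<longleftrightarrow> \<Prod>S dvd f i \<and> \<Prod>R dvd f i"
        using Prod_primes_dvd_iff[OF finS Fprime, OF that(1) that(1), of "f i"]
          Prod_primes_dvd_iff[OF finS Fprime, OF that(2) that(2), of "f i"] by blast
      then show ?thesis by simp
    qed
    then show "(\<Sum>S\<in>F. if \<Prod>S dvd f i then w S else 0)\<^sup>2 =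
      (\<Sum>S\<in>F. \<Sum>R\<in>F. w S * w R * (if \<Prod>(S \<union> R) dvd f i then 1 else 0))"
      unfolding power2_eq_square sum_product by (intro sum.cong refl)
  qed
  also have "\<dots> = (\<Sum>S\<in>F. \<Sum>R\<in>F. \<Sum>i\<in>I. w S * w R * (if \<Prod>(S \<union> R) dvd f i then 1 else 0))"
    by (rule sum_swap_inner[symmetric])
  also have "\<dots> = (\<Sum>S\<in>F. \<Sum>R\<in>F. w S * w R * real (card {i \<in> I. \<Prod>(S \<union> R) dvd f i}))"
    using I by (simp add: sum.inter_filter[symmetric] sum_distrib_left[symmetric])
  also have "\<dots> \<le> (\<Sum>S\<in>F. \<Sum>R\<in>F. X * (w S * w R / real (\<Prod>(S \<union> R))) + real D * real D)"
  proof (intro sum_mono)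
    fix S R assume SR: "S \<in> F" "R \<in> F"
    define c where "c = real (card {i \<in> I. \<Prod>(S \<union> R) dvd f i})"
    have lev: "\<bar>c - X / real (\<Prod>(S \<union> R))\<bar> \<le> 1"
      unfolding c_def by (rule level) (use SR in \<open>auto simp: F_def\<close>)
    have "w S * w R * c - X * (w S * w R / real (\<Prod>(S \<union> R))) = w S * w R * (c - X / real (\<Prod>(S \<union> R)))"
      by (simp add: algebra_simps)
    also have "\<dots> \<le> \<bar>w S\<bar> * \<bar>w R\<bar> * \<bar>c - X / real (\<Prod>(S \<union> R))\<bar>"
      by (metis abs_ge_self abs_mult)
    also have "\<dots> \<le> real D * real D * 1"
      using wabs SR lev by (intro mult_mono) auto
    finally show "w S * w R * c \<le> X * (w S * w R / real (\<Prod>(S \<union> R))) + real D * real D" by simp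
  qed
  also have "\<dots> = X * (1 / G) + real (card F) * real (card F) * (real D * real D)"
    unfolding sum.distrib sum_distrib_left[symmetric] diag by simp
  also have "real (card F) * real (card F) * (real D * real D) \<le> real D * real D * (real D * real D)"
    using cardF by (intro mult_right_mono mult_mono) auto
  finally show ?thesis by (simp add: power4_eq_xxxx mult_ac)
qed

section \<open>Lower bound for the sieve's main sum when the primes of Q may not sift\<close>

lemma sum_inverse_squares_le:
  "(\<Sum>k=1..n. 1 / real k ^ 2) \<le> 2"
proof -
  have "(\<Sum>k=1..Suc n. 1 / real k ^ 2) \<le> 2 - 1 / real (Suc n)" for n
  proof (induction n)
    case (Suc n)
    have "1 / real (Suc (Suc n)) ^ 2 \<le> 1 / real (Suc n) - 1 / real (Suc (Suc n))"
      by (simp add: divide_simps power2_eq_square)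
    then show ?case using Suc by simp
  qed simp
  then have "(\<Sum>k=1..Suc n. 1 / real k ^ 2) \<le> 2" for n
    by (smt (verit) divide_nonneg_nonneg of_nat_0_le_iff)
  then show ?thesis by (cases n) auto
qed

text \<open>Each n \<le> D is a squarefree product of primes outside Q, times a product of distinct
  primes of Q, times a square. Letting the three factors vary independently bounds the harmonic sum;
  the squares contribute at most 2, and the product over Q is the price of leaving Q out of the
  sieve.\<close>

lemma harm_le_sum_squarefree:
  fixes Q :: "nat set" and D :: nat
  assumes Q: "finite Q" "\<And>p. p \<in> Q \<Longrightarrow> prime p"
  defines "P \<equiv> {p. prime p \<and> p \<le> D \<and> p \<notin> Q}"
  shows "harm D \<le> 2 * (\<Prod>p\<in>Q. 1 + 1 / real p) * (\<Sum>S | S \<subseteq> P \<and> \<Prod>S \<le> D. 1 / real (\<Prod>S))"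
proof -
  note [simp del] = of_nat_prod
  define F where "F = {S. S \<subseteq> P \<and> \<Prod>S \<le> D}"
  define s :: "nat \<Rightarrow> nat set" where "s = (\<lambda>n. prime_factors (squarefree_part n))"
  define g where "g = (\<lambda>n. (s n - Q, s n \<inter> Q, square_part n))"
  define h :: "nat set \<times> nat set \<times> nat \<Rightarrow> real"
    where "h = (\<lambda>(S, R, k). 1 / real (\<Prod>S) * (1 / real (\<Prod>R) * (1 / real k ^ 2)))"
  have finP: "finite P" unfolding P_def by simp
  have finF: "finite F" unfolding F_def using finP by (auto intro: finite_subset[of _ "Pow P"])
  have fins: "finite (s n)" for n unfolding s_def by simp
  have s: "\<Prod>(s n) = squarefree_part n" for n
  proof -
    have "squarefree_part n = (\<Prod>p\<in>prime_factors (squarefree_part n). p ^ multiplicity p (squarefree_part n))"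
      by (rule prime_factorization_nat) (metis squarefree_part_nonzero gr0I)
    also have "\<dots> = (\<Prod>p\<in>prime_factors (squarefree_part n). p)"
    proof (rule prod.cong[OF refl])
      fix p assume p: "p \<in> prime_factors (squarefree_part n)"
      then have "multiplicity p (squarefree_part n) > 0" "prime p"
        by (auto simp: prime_factors_multiplicity)
      then have "multiplicity p (squarefree_part n) = 1"
        using prime_multiplicity_squarefree_part_le_Suc_0[of p n] by linarith
      then show "p ^ multiplicity p (squarefree_part n) = p" by simp
    qed
    finally show ?thesis unfolding s_def by simp
  qed
  have split: "\<Prod>(s n - Q) * \<Prod>(s n \<inter> Q) * square_part n ^ 2 = n" for n
  proof -
    have "\<Prod>(s n - Q) * \<Prod>(s n \<inter> Q) = \<Prod>(s n)"
      using prod.Int_Diff[OF fins, of "\<lambda>p. p" n Q] by (simp add: mult.commute)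
    then show ?thesis using squarefree_decompose[of n] s by simp
  qed
  have "harm D = (\<Sum>n=1..D. h (g n))"
    unfolding harm_def
  proof (rule sum.cong[OF refl])
    fix n
    have "h (g n) = 1 / real (\<Prod>(s n - Q) * \<Prod>(s n \<inter> Q) * square_part n ^ 2)"
      unfolding h_def g_def by simp
    then show "inverse (of_nat n) = h (g n)" unfolding split by (simp add: inverse_eq_divide)
  qed
  also have "\<dots> = sum h (g ` {1..D})"
  proof -
    have "inj_on g {1..D}"
    proof (rule inj_onI)
      fix m n assume "g m = g n"
      then have "s m - Q = s n - Q" "s m \<inter> Q = s n \<inter> Q" "square_part m = square_part n"
        unfolding g_def by auto
      then show "m = n" by (metis split)
    qed
    then show ?thesis by (simp add: sum.reindex)
  qed
  also have "\<dots> \<le> sum h (F \<times> Pow Q \<times> {1..D})"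
  proof (rule sum_mono2)
    show "finite (F \<times> Pow Q \<times> {1..D})" using finF Q by simp
    show "g ` {1..D} \<subseteq> F \<times> Pow Q \<times> {1..D}"
    proof
      fix y assume "y \<in> g ` {1..D}"
      then obtain n where n: "n \<in> {1..D}" "y = g n" by blast
      have a: "\<Prod>(s n - Q) dvd n" and b: "square_part n ^ 2 dvd n"
        using split[of n] by (metis dvd_triv_left mult.assoc, metis dvd_triv_right)
      have "square_part n dvd n" using b by (metis dvd_mult_left power2_eq_square)
      then have c: "square_part n \<in> {1..D}"
        using n dvd_imp_le[of "square_part n" n] by (auto simp: Suc_le_eq intro!: Nat.gr0I)
      have d: "\<Prod>(s n - Q) \<le> D" using n dvd_imp_le[OF a] by auto
      have "s n - Q \<subseteq> P"
      proof
        fix p assume p: "p \<in> s n - Q"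
        then have "prime p" "p dvd squarefree_part n" unfolding s_def by (auto simp: in_prime_factors_iff)
        then have "p dvd n" by (metis dvd_mult2 squarefree_decompose)
        then have "p \<le> D" using n dvd_imp_le[of p n] by auto
        then show "p \<in> P" using p \<open>prime p\<close> unfolding P_def by simp
      qed
      then show "y \<in> F \<times> Pow Q \<times> {1..D}" using n c d unfolding g_def F_def by auto
    qed
    show "\<And>b. b \<in> F \<times> Pow Q \<times> {1..D} - g ` {1..D} \<Longrightarrow> 0 \<le> h b"
      unfolding h_def by auto
  qed
  also have "\<dots> = (\<Sum>S\<in>F. 1 / real (\<Prod>S)) * ((\<Sum>R\<in>Pow Q. 1 / real (\<Prod>R)) * (\<Sum>k=1..D. 1 / real k ^ 2))"
    unfolding sum_product sum.cartesian_product h_def by (simp add: case_prod_unfold)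
  also have "(\<Sum>R\<in>Pow Q. 1 / real (\<Prod>R)) = (\<Prod>p\<in>Q. 1 + 1 / real p)"
  proof -
    have "(\<Prod>p\<in>Q. 1 / real p + 1) = (\<Sum>R\<in>Pow Q. (\<Prod>p\<in>R. 1 / real p) * (\<Prod>p\<in>Q - R. 1))"
      using Q(1) by (rule prod_add)
    then show ?thesis by (simp add: prod_dividef of_nat_prod add.commute)
  qed
  also have "(\<Sum>S\<in>F. 1 / real (\<Prod>S)) * ((\<Prod>p\<in>Q. 1 + 1 / real p) * (\<Sum>k=1..D. 1 / real k ^ 2)) \<le>
    (\<Sum>S\<in>F. 1 / real (\<Prod>S)) * ((\<Prod>p\<in>Q. 1 + 1 / real p) * 2)"
    by (intro mult_left_mono sum_inverse_squares_le sum_nonneg prod_nonneg) auto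
  finally show ?thesis unfolding F_def by (simp add: mult_ac)
qed

section \<open>Primes with prescribed order of 2\<close>

text \<open>Lifting the exponent by one prime. Modulo q the sum is l, which settles l \<noteq> q.
  For l = q put A = 1 + q B: modulo q^2 the sum is q + (q (q - 1) / 2) q B, and q (q - 1) / 2 is a
  multiple of q because q is odd. So q divides the sum exactly once.\<close>

lemma multiplicity_geometric_sum_le:
  fixes q A l :: nat
  assumes q: "prime q" "odd q" and A: "[A = 1] (mod q)" and l: "prime l"
  shows "multiplicity q (\<Sum>i<l. A ^ i) \<le> multiplicity q l"
proof (cases "l = q")
  case False
  have "[(\<Sum>i<l. A ^ i) = (\<Sum>i<l. 1 ^ i)] (mod q)"
    by (intro cong_sum cong_pow A)
  then have "q dvd (\<Sum>i<l. A ^ i) \<longleftrightarrow> q dvd l"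
    by (simp add: cong_dvd_iff)
  moreover have "\<not> q dvd l" using False q l primes_dvd_imp_eq by blast
  ultimately show ?thesis by (simp add: not_dvd_imp_multiplicity_0)
next
  case True
  have "\<not> q ^ 2 dvd (\<Sum>i<q. A ^ i)"
  proof
    assume "q ^ 2 dvd (\<Sum>i<q. A ^ i)"
    then have dv: "int q ^ 2 dvd (\<Sum>i<q. int A ^ i)"
      by (metis (mono_tags, lifting) int_dvd_int_iff of_nat_power of_nat_sum sum.cong)
    have "[int A = 1] (mod int q)" using A by (metis cong_int_iff of_nat_1)
    then obtain B where B: "int A = 1 + int q * B"
      by (metis cong_iff_lin cong_sym)
    have pow: "[int A ^ i = 1 + int i * int q * B] (mod int q ^ 2)" for i
    proof (induction i)
      case (Suc i)
      have "[int A ^ Suc i = (1 + int i * int q * B) * (1 + int q * B)] (mod int q ^ 2)"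
        using cong_mult[OF Suc cong_refl[of "int A"]] unfolding B by (simp add: mult.commute)
      moreover have "(1 + int i * int q * B) * (1 + int q * B) =
        1 + int (Suc i) * int q * B + int q ^ 2 * (int i * B * B)"
        by (simp add: algebra_simps power2_eq_square)
      ultimately show ?case
        by (metis Cong.cong_def mod_mult_self2)
    qed simp
    have "[(\<Sum>i<q. int A ^ i) = (\<Sum>i<q. 1 + int i * int q * B)] (mod int q ^ 2)"
      by (intro cong_sum pow)
    also have "(\<Sum>i<q. 1 + int i * int q * B) = int q + int (\<Sum>i<q. i) * int q * B"
      by (simp add: sum.distrib sum_distrib_right)
    finally have c: "[(\<Sum>i<q. int A ^ i) = int q + int (\<Sum>i<q. i) * int q * B] (mod int q ^ 2)" .
    have "q dvd (\<Sum>i<q. i)"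
    proof -
      have "2 * (\<Sum>i<q. i) = q * (q - 1)"
        using gauss_sum_nat[of "q - 1"] q(1) prime_gt_0_nat[of q]
        by (auto simp: lessThan_nat_numeral atLeast0AtMost lessThan_Suc_atMost[symmetric])
      then have "q dvd 2 * (\<Sum>i<q. i)" by simp
      moreover have "coprime q 2" using q(2) by simp
      ultimately show ?thesis using coprime_dvd_mult_right_iff by blast
    qed
    then have "int q dvd int (\<Sum>i<q. i)" by (rule of_nat_dvd_iff[THEN iffD2])
    then have "int q ^ 2 dvd int (\<Sum>i<q. i) * int q * B"
      by (simp add: power2_eq_square mult_dvd_mono)
    moreover have "int q ^ 2 dvd int q + int (\<Sum>i<q. i) * int q * B"
      using dv c cong_dvd_iff by blast
    ultimately have "int q ^ 2 dvd int q"
      by (metis dvd_add_left_iff)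
    then have "q ^ 2 dvd q" by (metis int_dvd_int_iff of_nat_power)
    then have "q ^ 2 \<le> q" using prime_gt_0_nat[OF q(1)] by (rule dvd_imp_le)
    then show False using prime_gt_1_nat[OF q(1)] by (simp add: power2_eq_square)
  qed
  then have "multiplicity q (\<Sum>i<q. A ^ i) < 2"
    by (meson multiplicity_dvd' not_less)
  moreover have "multiplicity q q = 1"
    using q(1) prime_gt_1_nat[of q] by (intro multiplicity_self) auto
  ultimately show ?thesis using True by simp
qed

lemma proper_dvd_obtain_prime:
  fixes d m :: nat
  assumes "d dvd m" "d \<noteq> m" "m > 0"
  obtains l where "prime l" "l dvd m" "d dvd m div l"
proof -
  obtain k where k: "m = d * k" using assms(1) by blast
  then have "k \<noteq> 1" using assms by auto
  then obtain l where l: "prime l" "l dvd k" using prime_factor_nat by blast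
  then obtain j where j: "k = l * j" by blast
  have "m div l = d * j" using k j prime_gt_0_nat[OF l(1)] by simp
  then show ?thesis using that[of l] l k by simp
qed

lemma Suc_square_le_power2: "m \<ge> 6 \<Longrightarrow> (m + 1)\<^sup>2 \<le> 2 ^ m" for m :: nat
proof (induction m rule: dec_induct)
  case (step m)
  have "(Suc m + 1)\<^sup>2 \<le> 2 * (m + 1)\<^sup>2"
    using mult_le_mono[OF step(1) step(1)] by (simp add: power2_eq_square)
  then show ?case using step by simp
qed simp

text \<open>A special case of Zsigmondy's theorem: if every prime divisor \<open>q\<close> of \<open>2 ^ m - 1\<close> already divided
  some \<open>2 ^ (m div l) - 1\<close>, lifting the exponent would give
  \<open>2 ^ m - 1 dvd (\<Prod>l. l * (2 ^ (m div l) - 1))\<close>, which is too small.\<close>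

lemma ex_prime_ord_eq:
  fixes m :: nat
  assumes m: "m \<ge> 6" and small: "(\<Sum>l\<in>prime_factors m. 1 / real l) \<le> 1 / 2"
  shows "\<exists>q :: nat. prime q \<and> ord q 2 = m"
proof (rule ccontr)
  assume none: "\<not> ?thesis"
  define Z where "Z = (\<Prod>l\<in>prime_factors m. l * (2 ^ (m div l) - 1 :: nat))"
  have div_pos: "m div l > 0" if "l \<in> prime_factors m" for l
    using that m by (auto simp: in_prime_factors_iff div_greater_zero_iff dvd_imp_le prime_gt_0_nat)
  have Zpos: "Z > 0" unfolding Z_def
  proof (rule prod_pos)
    fix l assume "l \<in> prime_factors m"
    then show "0 < l * (2 ^ (m div l) - 1 :: nat)"
      using div_pos[of l] one_less_power[of "2::nat" "m div l"]
      by (auto simp: in_prime_factors_iff prime_gt_0_nat)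
  qed
  have pm: "(2 ^ m - 1 :: nat) \<noteq> 0" using m one_less_power[of "2::nat" m] by simp
  have "2 ^ m - 1 dvd Z"
  proof (rule multiplicity_le_imp_dvd[OF pm])
    fix q :: nat assume q: "prime q"
    show "multiplicity q (2 ^ m - 1) \<le> multiplicity q Z"
    proof (cases "q dvd 2 ^ m - 1")
      case False
      then show ?thesis by (simp add: not_dvd_imp_multiplicity_0)
    next
      case True
      then have "[2 ^ m = 1] (mod q)" by (simp add: cong_altdef_nat)
      then have "ord q 2 dvd m" by (simp only: ord_divides)
      moreover have "ord q 2 \<noteq> m" using none q by auto
      ultimately obtain l where l: "prime l" "l dvd m" "ord q 2 dvd m div l"
        using proper_dvd_obtain_prime m by (metis gr0I not_numeral_le_zero)
      define A :: nat where "A = 2 ^ (m div l)"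
      have lm: "l \<in> prime_factors m" using l m by (auto simp: in_prime_factors_iff)
      have A1: "[A = 1] (mod q)" unfolding A_def using l(3) by (simp only: ord_divides)
      have "odd q"
      proof
        assume "even q"
        then have "(2::nat) dvd 2 ^ m - 1" using True dvd_trans by blast
        then show False using m by simp
      qed
      have "2 ^ m = A ^ l" unfolding A_def using l(2) by (simp flip: power_mult)
      moreover have "A ^ l - 1 = (A - 1) * (\<Sum>i<l. A ^ i)"
      proof -
        have "int (A ^ l - 1) = int ((A - 1) * (\<Sum>i<l. A ^ i))"
          using power_diff_1_eq[of "int A" l] unfolding A_def by (simp add: of_nat_diff)
        then show ?thesis by (simp only: of_nat_eq_iff)
      qed
      ultimately have e: "2 ^ m - 1 = (A - 1) * (\<Sum>i<l. A ^ i)" by simp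
      then have nz: "A - 1 \<noteq> 0" "(\<Sum>i<l. A ^ i) \<noteq> 0" using pm by auto
      have "multiplicity q (2 ^ m - 1) = multiplicity q (A - 1) + multiplicity q (\<Sum>i<l. A ^ i)"
        unfolding e using q nz by (intro prime_elem_multiplicity_mult_distrib) auto
      also have "\<dots> \<le> multiplicity q (A - 1) + multiplicity q l"
        using multiplicity_geometric_sum_le[OF q \<open>odd q\<close> A1 l(1)] by simp
      also have "\<dots> = multiplicity q (l * (A - 1))"
        using q nz prime_gt_0_nat[OF l(1)] by (subst prime_elem_multiplicity_mult_distrib) auto
      also have "\<dots> \<le> multiplicity q Z"
      proof (rule dvd_imp_multiplicity_le)
        show "l * (A - 1) dvd Z" unfolding Z_def A_def using lm by (intro dvd_prodI) auto
      qed (use Zpos in auto)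
      finally show ?thesis .
    qed
  qed
  then have le: "2 ^ m - 1 \<le> Z" using Zpos by (rule dvd_imp_le)
  \<comment> \<open>The primes dividing m multiply to at most m, and the exponents m / l add up to
    at most m / 2 by \<open>small\<close>; so Z \<le> m s, where s^2 = 2^m. But m \<ge> 6 gives s
    \<ge> m + 1, and then s^2 - 1 \<le> m s is impossible.\<close>
  define s where "s = 2 powr (real m / 2)"
  have "real Z \<le> (\<Prod>l\<in>prime_factors m. real l * 2 powr (real m * (1 / real l)))"
  proof -
    have "real (l * (2 ^ (m div l) - 1)) \<le> real l * 2 powr (real m * (1 / real l))"
      if "l \<in> prime_factors m" for l
    proof -
      have "l dvd m" "l > 0" using that by (auto simp: in_prime_factors_iff prime_gt_0_nat)
      then have "real (2 ^ (m div l)) = 2 powr (real m * (1 / real l))"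
        by (auto simp: powr_realpow)
      moreover have "real (2 ^ (m div l) - 1) \<le> real (2 ^ (m div l))"
        by (intro of_nat_mono) simp
      ultimately show ?thesis by (simp add: mult_left_mono)
    qed
    then show ?thesis unfolding Z_def of_nat_prod by (intro prod_mono) auto
  qed
  also have "\<dots> = real (\<Prod>(prime_factors m)) * 2 powr (real m * (\<Sum>l\<in>prime_factors m. 1 / real l))"
    by (simp add: prod.distrib powr_sum sum_distrib_left)
  also have "\<dots> \<le> real m * s"
  proof (intro mult_mono)
    have "\<Prod>(prime_factors m) dvd m"
      by (subst Prod_primes_dvd_iff) (auto simp: in_prime_factors_iff)
    then show "real (\<Prod>(prime_factors m)) \<le> real m" using m by (intro of_nat_mono dvd_imp_le) auto
    show "2 powr (real m * (\<Sum>l\<in>prime_factors m. 1 / real l)) \<le> s"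
      unfolding s_def using mult_left_mono[OF small, of "real m"] by simp
  qed auto
  finally have Zle: "real Z \<le> real m * s" .
  have ss: "s * s = 2 ^ m"
    unfolding s_def by (simp add: powr_add[symmetric] powr_realpow)
  have "(real m + 1)\<^sup>2 \<le> 2 ^ m"
    using of_nat_mono[OF Suc_square_le_power2[OF m], where ?'a = real] by (simp add: add.commute)
  also have "\<dots> = s\<^sup>2" using ss by (simp add: power2_eq_square)
  finally have s1: "real m + 1 \<le> s"
    using power2_le_imp_le[of "real m + 1" s] unfolding s_def by simp
  have "s * s - 1 = real (2 ^ m - 1)" using ss by (simp add: of_nat_diff)
  also have "\<dots> \<le> real m * s" using le Zle by (meson of_nat_mono order_trans)
  finally have "s * s - 1 \<le> real m * s" .
  moreover have "(real m + 1) * s \<le> s * s" using s1 by (intro mult_right_mono) auto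
  ultimately have "s \<le> 1" by (simp add: algebra_simps)
  then show False using s1 m by simp
qed

section \<open>Harmonic sum of the odd orders with few small prime factors\<close>

lemma harm_le_sum_odd: "harm M \<le> 2 * (\<Sum>m | odd m \<and> m \<le> M. 1 / real m)"
proof -
  have "harm M = (\<Sum>m=1..M. 1 / real m)" by (simp add: harm_def inverse_eq_divide)
  also have "{1..M} = {m. odd m \<and> m \<le> M} \<union> {m. even m \<and> 1 \<le> m \<and> m \<le> M}"
    by (auto simp: Suc_le_eq odd_pos)
  also have "(\<Sum>m\<in>\<dots>. 1 / real m) = (\<Sum>m | odd m \<and> m \<le> M. 1 / real m) + (\<Sum>m | even m \<and> 1 \<le> m \<and> m \<le> M. 1 / real m)"
    by (intro sum.union_disjoint) auto
  also have "(\<Sum>m | even m \<and> 1 \<le> m \<and> m \<le> M. 1 / real m) \<le> (\<Sum>m | odd m \<and> m \<le> M. 1 / real m)"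
  proof (rule sum_le_included[where i = Suc])
    show "\<forall>x\<in>{m. even m \<and> 1 \<le> m \<and> m \<le> M}. \<exists>y\<in>{m. odd m \<and> m \<le> M}. Suc y = x \<and> 1 / real x \<le> 1 / real y"
    proof
      fix x assume "x \<in> {m. even m \<and> 1 \<le> m \<and> m \<le> M}"
      then have x: "even x" "1 \<le> x" "x \<le> M" by auto
      then have "x - 1 > 0" by presburger
      then show "\<exists>y\<in>{m. odd m \<and> m \<le> M}. Suc y = x \<and> 1 / real x \<le> 1 / real y"
        using x by (intro bexI[of _ "x - 1"]) (auto simp: frac_le)
    qed
  qed auto
  finally show ?thesis by simp
qed

text \<open>1 / (2k + 1)^2 is less than (1 / k - 1 / (k + 1)) / 4, which telescopes. A bound below 1
  / 2 is what the averaging over odd orders requires.\<close>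

lemma sum_inverse_odd_squares_le: "(\<Sum>l | odd l \<and> 3 \<le> l \<and> l \<le> M. 1 / real l ^ 2) \<le> 1 / 4"
proof -
  have *: "(\<Sum>k=1..n. 1 / real (2 * k + 1) ^ 2) \<le> 1 / 4 - 1 / (4 * real (n + 1))" for n
  proof (induction n)
    case (Suc n)
    have "1 / real (2 * Suc n + 1) ^ 2 \<le> 1 / (4 * real (n + 1)) - 1 / (4 * real (Suc n + 1))"
      by (simp add: divide_simps power2_eq_square) (simp add: algebra_simps)
    then show ?case using Suc by simp
  qed simp
  have "(\<Sum>l | odd l \<and> 3 \<le> l \<and> l \<le> M. 1 / real l ^ 2) \<le> (\<Sum>k=1..M. 1 / real (2 * k + 1) ^ 2)"
    by (rule sum_le_included[where i = "\<lambda>k. 2 * k + 1"]) (auto elim!: oddE)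
  also have "\<dots> \<le> 1 / 4" using *[of M] by (smt (verit) divide_nonneg_nonneg of_nat_0_le_iff)
  finally show ?thesis .
qed

text \<open>Markov's inequality with weights 1 / m. Writing m = l k splits 1 / (m l) into 1 / l^2
  times 1 / k, so the weighted mean of \<sigma> over odd m is at most 1 / 4. As 1 - 2 \<sigma> is at
  most 1, and negative once \<sigma> > 1 / 2, the good m carry at least half of the odd harmonic
  sum, apart from the m below 9, which contribute at most 1 + 1/3 + 1/5 + 1/7 < 2. For even m the
  prime 2 alone would use up the allowance 1 / 2.\<close>

lemma sum_good_orders_ge:
  "(\<Sum>m | odd m \<and> 9 \<le> m \<and> m \<le> M \<and> (\<Sum>l\<in>prime_factors m. 1 / real l) \<le> 1 / 2. 1 / real m)
     \<ge> harm M / 4 - 2"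
proof -
  define Odds where "Odds = {m. odd m \<and> m \<le> M}"
  define \<sigma> where "\<sigma> = (\<lambda>m. \<Sum>l\<in>prime_factors m. 1 / real l)"
  define Good where "Good = {m. odd m \<and> 9 \<le> m \<and> m \<le> M \<and> \<sigma> m \<le> 1 / 2}"
  define L where "L = {l. odd l \<and> 3 \<le> l \<and> l \<le> M}"
  have fin: "finite Odds" "finite Good" "finite L" unfolding Odds_def Good_def L_def by auto
  have "(\<Sum>m\<in>Odds. 1 / real m * \<sigma> m) = (\<Sum>(m, l)\<in>Sigma Odds prime_factors. 1 / real m * (1 / real l))"
    unfolding \<sigma>_def sum_distrib_left using fin by (intro sum.Sigma) auto
  also have "\<dots> \<le> (\<Sum>(l, m)\<in>L \<times> Odds. 1 / real l ^ 2 * (1 / real m))"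
  proof (rule sum_le_included[where i = "\<lambda>(l, m). (l * m, l)"])
    show "\<forall>x\<in>Sigma Odds prime_factors. \<exists>y\<in>L \<times> Odds. (case y of (l, m) \<Rightarrow> (l * m, l)) = x \<and>
      (case x of (m, l) \<Rightarrow> 1 / real m * (1 / real l)) \<le> (case y of (l, m) \<Rightarrow> 1 / real l ^ 2 * (1 / real m))"
    proof
      fix x assume "x \<in> Sigma Odds prime_factors"
      then obtain m l where x: "x = (m, l)" "m \<in> Odds" "l \<in> prime_factors m" by auto
      then obtain k where k: "m = l * k" "prime l" by (auto simp: in_prime_factors_iff)
      have m: "odd m" "m \<le> M" "m > 0" using x(2) unfolding Odds_def by (auto intro: odd_pos)
      have "odd l" "odd k" using m k by auto
      moreover have "l \<noteq> 1" "l \<noteq> 0" "l \<noteq> 2" using k(2) \<open>odd l\<close> by auto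
      moreover have "l \<le> m" "k \<le> m" using m k by auto
      ultimately have "(l, k) \<in> L \<times> Odds" using m unfolding L_def Odds_def by auto
      then show "\<exists>y\<in>L \<times> Odds. (case y of (l, m) \<Rightarrow> (l * m, l)) = x \<and>
        (case x of (m, l) \<Rightarrow> 1 / real m * (1 / real l)) \<le> (case y of (l, m) \<Rightarrow> 1 / real l ^ 2 * (1 / real m))"
        using x k by (intro bexI[of _ "(l, k)"]) (auto simp: power2_eq_square mult_ac)
    qed
  qed (use fin in auto)
  also have "\<dots> = (\<Sum>l\<in>L. 1 / real l ^ 2) * (\<Sum>m\<in>Odds. 1 / real m)"
    unfolding sum_product sum.cartesian_product ..
  also have "\<dots> \<le> 1 / 4 * (\<Sum>m\<in>Odds. 1 / real m)"
    unfolding L_def by (intro mult_right_mono sum_inverse_odd_squares_le sum_nonneg) auto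
  finally have 1: "(\<Sum>m\<in>Odds. 1 / real m * \<sigma> m) \<le> 1 / 4 * (\<Sum>m\<in>Odds. 1 / real m)" .
  have "harm M / 4 \<le> 1 / 2 * (\<Sum>m\<in>Odds. 1 / real m)"
    using harm_le_sum_odd[of M] unfolding Odds_def by simp
  also have "\<dots> \<le> (\<Sum>m\<in>Odds. 1 / real m * (1 - 2 * \<sigma> m))"
  proof -
    have "(\<Sum>m\<in>Odds. 1 / real m * (1 - 2 * \<sigma> m)) = (\<Sum>m\<in>Odds. 1 / real m) - 2 * (\<Sum>m\<in>Odds. 1 / real m * \<sigma> m)"
      unfolding sum_distrib_left sum_subtractf[symmetric] by (intro sum.cong refl) (simp add: algebra_simps)
    then show ?thesis using 1 by simp
  qed
  also have "\<dots> \<le> (\<Sum>m\<in>Odds. if m \<in> Good then 1 / real m else if m < 9 then 1 / real m else 0)"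
  proof (rule sum_mono)
    fix m assume "m \<in> Odds"
    have "\<sigma> m \<ge> 0" unfolding \<sigma>_def by (intro sum_nonneg) auto
    then have "1 / real m * (1 - 2 * \<sigma> m) \<le> 1 / real m * 1" by (intro mult_left_mono) auto
    moreover have "1 / real m * (1 - 2 * \<sigma> m) \<le> 0" if "\<sigma> m > 1 / 2"
      using that by (intro mult_nonneg_nonpos) auto
    ultimately show "1 / real m * (1 - 2 * \<sigma> m) \<le> (if m \<in> Good then 1 / real m else if m < 9 then 1 / real m else 0)"
      using \<open>m \<in> Odds\<close> unfolding Good_def Odds_def by auto
  qed
  also have "\<dots> \<le> (\<Sum>m\<in>Odds. if m \<in> Good then 1 / real m else 0) + (\<Sum>m\<in>Odds. if m < 9 then 1 / real m else 0)"
    unfolding sum.distrib[symmetric] by (intro sum_mono) auto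
  also have "(\<Sum>m\<in>Odds. if m \<in> Good then 1 / real m else 0) = (\<Sum>m\<in>Good. 1 / real m)"
    using fin by (simp add: sum.inter_filter[symmetric]) (intro sum.cong, auto simp: Good_def Odds_def)
  also have "(\<Sum>m\<in>Odds. if m < 9 then 1 / real m else 0) \<le> (\<Sum>m\<in>{1,3,5,7}. 1 / real m)"
  proof -
    have "(\<Sum>m\<in>Odds. if m < 9 then 1 / real m else 0) = (\<Sum>m | m \<in> Odds \<and> m < 9. 1 / real m)"
      using fin by (simp add: sum.inter_filter)
    also have "\<dots> \<le> (\<Sum>m\<in>{1,3,5,7}. 1 / real m)"
    proof (rule sum_mono2)
      have "m = 1 \<or> m = 3 \<or> m = 5 \<or> m = 7" if "odd m" "m < 9" for m :: nat
        using that by presburger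
      then show "{m \<in> Odds. m < 9} \<subseteq> {1,3,5,7}" unfolding Odds_def by blast
    qed auto
    finally show ?thesis .
  qed
  also have "\<dots> \<le> 2" by simp
  finally show ?thesis unfolding Good_def \<sigma>_def by simp
qed

section \<open>Chebyshev's estimate for sums of reciprocals of primes\<close>

text \<open>With n = 2^j, the primes in (n, 2n] all divide the central binomial coefficient, which
  is at most 2^(2n). Each exceeds 2^j, so there are at most 2n / j of them, with reciprocals at most
  1 / n.\<close>

lemma sum_inverse_primes_dyadic:
  assumes "j \<ge> 1"
  shows "(\<Sum>p | prime p \<and> 2 ^ j < p \<and> p \<le> 2 ^ Suc j. 1 / real p) \<le> 2 / real j"
proof -
  define n :: nat where "n = 2 ^ j"
  define S where "S = {p. prime p \<and> n < p \<and> p \<le> 2 * n}"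
  have fin: "finite S" unfolding S_def by simp
  have "p dvd (2 * n choose n)" if "p \<in> S" for p
  proof -
    have p: "prime p" "n < p" "p \<le> 2 * n" using that unfolding S_def by auto
    have "p dvd fact (2 * n)" using p by (simp add: prime_dvd_fact_iff)
    also have "fact (2 * n) = fact n * fact n * (2 * n choose n)"
      using binomial_fact_lemma[of n "2 * n"] by (simp add: mult_2)
    finally show ?thesis using p by (simp add: prime_dvd_mult_iff prime_dvd_fact_iff)
  qed
  then have "\<Prod>S dvd (2 * n choose n)"
    using fin by (subst Prod_primes_dvd_iff) (auto simp: S_def)
  then have "\<Prod>S \<le> (2 * n choose n)" by (rule dvd_imp_le) simp
  also have "\<dots> \<le> 2 ^ (2 * n)"
    using choose_row_sum[of "2 * n"] member_le_sum[of n "{..2 * n}" "\<lambda>k. 2 * n choose k"] by simp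
  finally have "\<Prod>S \<le> 2 ^ (2 * n)" .
  moreover have "n ^ card S \<le> \<Prod>S"
    using prod_mono[of S "\<lambda>_. n" "\<lambda>p. p"] by (auto simp: S_def)
  ultimately have "(2::nat) ^ (j * card S) \<le> 2 ^ (2 * n)"
    unfolding n_def by (simp add: power_mult)
  then have jc: "j * card S \<le> 2 * n" by simp
  have "(\<Sum>p\<in>S. 1 / real p) \<le> real (card S) * (1 / real n)"
    by (rule sum_bounded_above) (auto simp: S_def n_def frac_le)
  also have "\<dots> \<le> 2 / real j"
  proof -
    have "real j * real (card S) \<le> 2 * real n" using jc by (metis of_nat_mono of_nat_mult of_nat_numeral)
    then show ?thesis using assms by (simp add: field_simps n_def)
  qed
  finally show ?thesis unfolding S_def n_def by simp
qed

text \<open>One dyadic block at a time, starting from 1 / 2 for the prime 2. For M = 2^(J+1) the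
  bound has order log log M, so its exponential is only a power of log M.\<close>

lemma sum_inverse_primes_le:
  "(\<Sum>p | prime p \<and> p \<le> 2 ^ Suc J. 1 / real p) \<le> 1 / 2 + 2 * harm J"
proof (induction J)
  case 0
  have "{p. prime p \<and> p \<le> (2::nat)} = {2}"
    using prime_ge_2_nat by (auto simp: le_antisym)
  then show ?case by (simp add: harm_def)
next
  case (Suc J)
  have "{p. prime p \<and> p \<le> (2::nat) ^ Suc (Suc J)} =
    {p. prime p \<and> p \<le> 2 ^ Suc J} \<union> {p. prime p \<and> 2 ^ Suc J < p \<and> p \<le> 2 ^ Suc (Suc J)}"
    by (auto simp: not_le intro: order_trans)
  then have "(\<Sum>p | prime p \<and> p \<le> 2 ^ Suc (Suc J). 1 / real p) =
    (\<Sum>p | prime p \<and> p \<le> 2 ^ Suc J. 1 / real p) +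
    (\<Sum>p | prime p \<and> 2 ^ Suc J < p \<and> p \<le> 2 ^ Suc (Suc J). 1 / real p)"
    by (simp only:) (intro sum.union_disjoint, auto)
  also have "\<dots> \<le> 1 / 2 + 2 * harm J + 2 / real (Suc J)"
    using Suc sum_inverse_primes_dyadic[of "Suc J"] by simp
  finally show ?case by (simp add: harm_Suc inverse_eq_divide)
qed

section \<open>Covering almost all pairs of exponents\<close>

lemma card_ge_average_fibre:
  assumes "finite U" "finite Y" "Y \<noteq> {}" "f ` U \<subseteq> Y"
  shows "\<exists>y\<in>Y. real (card U) / real (card Y) \<le> real (card {x \<in> U. f x = y})"
proof (rule ccontr)
  assume "\<not> ?thesis"
  then have less: "real (card {x \<in> U. f x = y}) < real (card U) / real (card Y)" if "y \<in> Y" for y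
    using that by (auto simp: not_le)
  have "card U = (\<Sum>y\<in>Y. card {x \<in> U. f x = y})"
    using sum.group[OF assms(1,2,4), where h = "\<lambda>_. 1 :: nat"] by simp
  then have "real (card U) = (\<Sum>y\<in>Y. real (card {x \<in> U. f x = y}))" by simp
  also have "\<dots> < (\<Sum>y\<in>Y. real (card U) / real (card Y))"
    using assms less by (intro sum_strict_mono) auto
  also have "\<dots> = real (card U)" using assms by simp
  finally show False by simp
qed

text \<open>Sort the pairs that survive the earlier moduli by (u, a mod m). There are T m classes,
  so a largest one holds at least the average share, and the new residue is chosen to delete it. As
  each choice adapts to what is left, the savings multiply without any independence of the
  moduli.\<close>

lemma greedy_cover:
  fixes U :: "(nat \<times> nat) set"
  assumes U: "finite U" "\<And>a u. (a, u) \<in> U \<Longrightarrow> u < T" and T: "T > 0"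
    and M: "finite M" "\<And>m. m \<in> M \<Longrightarrow> (m :: nat) > 0"
  shows "\<exists>c t. real (card {(a, u) \<in> U. \<forall>m\<in>M. \<not> (u = t m \<and> [a = c m] (mod m))})
    \<le> real (card U) * (\<Prod>m\<in>M. 1 - 1 / (real T * real m))"
  using M
proof (induction M rule: finite_induct)
  case (insert m M)
  then obtain c t where ct: "real (card {(a, u) \<in> U. \<forall>m\<in>M. \<not> (u = t m \<and> [a = c m] (mod m))})
    \<le> real (card U) * (\<Prod>m\<in>M. 1 - 1 / (real T * real m))" by auto
  define V where "V = {(a, u) \<in> U. \<forall>m\<in>M. \<not> (u = t m \<and> [a = c m] (mod m))}"
  have V: "finite V" "V \<subseteq> U" using U(1) unfolding V_def by (auto intro: finite_subset)
  have m: "m > 0" using insert by simp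
  define f where "f = (\<lambda>(a :: nat, u :: nat). (u, a mod m))"
  have "f ` V \<subseteq> {..<T} \<times> {..<m}" using V(2) U(2) m unfolding f_def by auto
  moreover have "{..<T} \<times> {..<m} \<noteq> {}" using T m by (auto simp: lessThan_empty_iff)
  ultimately obtain y where y: "y \<in> {..<T} \<times> {..<m}"
    "real (card V) / real (card ({..<T} \<times> {..<m})) \<le> real (card {x \<in> V. f x = y})"
    using card_ge_average_fibre[OF V(1), of "{..<T} \<times> {..<m}" f] by blast
  define c' where "c' = c(m := snd y)"
  define t' where "t' = t(m := fst y)"
  define B where "B = {(a, u) \<in> U. \<forall>k\<in>insert m M. \<not> (u = t' k \<and> [a = c' k] (mod k))}"
  have "B \<subseteq> V - {x \<in> V. f x = y}"
  proof
    fix x assume x: "x \<in> B"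
    obtain a u where au: "x = (a, u)" by fastforce
    have "\<not> (u = t k \<and> [a = c k] (mod k))" if "k \<in> M" for k
    proof -
      have "k \<noteq> m" using that insert(2) by auto
      then show ?thesis using x that unfolding au B_def c'_def t'_def by auto
    qed
    moreover have "\<not> (u = fst y \<and> [a = snd y] (mod m))"
      using x unfolding au B_def c'_def t'_def by auto
    then have "f x \<noteq> y" unfolding au f_def Cong.cong_def by auto
    ultimately show "x \<in> V - {x \<in> V. f x = y}"
      using x unfolding au B_def V_def by simp
  qed
  then have "card B \<le> card (V - {x \<in> V. f x = y})"
    using V(1) by (intro card_mono) auto
  also have "\<dots> = card V - card {x \<in> V. f x = y}"
    using V(1) by (intro card_Diff_subset) auto
  finally have "card B + card {x \<in> V. f x = y} \<le> card V"
    using card_mono[OF V(1), of "{x \<in> V. f x = y}"] by auto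
  then have "real (card B) \<le> real (card V) - real (card {x \<in> V. f x = y})"
    by linarith
  also have "\<dots> \<le> real (card V) * (1 - 1 / (real T * real m))"
    using y(2) by (simp add: right_diff_distrib)
  also have "\<dots> \<le> real (card U) * (\<Prod>m\<in>M. 1 - 1 / (real T * real m)) * (1 - 1 / (real T * real m))"
  proof (rule mult_right_mono)
    have "1 \<le> T * m" using T m by (simp add: Suc_le_eq)
    then have "1 \<le> real T * real m" by (metis of_nat_1 of_nat_mono of_nat_mult)
    then show "0 \<le> 1 - 1 / (real T * real m)" by simp
  qed (use ct in \<open>simp add: V_def\<close>)
  also have "\<dots> = real (card U) * (\<Prod>m\<in>insert m M. 1 - 1 / (real T * real m))"
    using insert(1,2) by simp
  finally show ?case unfolding B_def by blast
qed simp

section \<open>Orders that are powers of two, from prime factors of Fermat numbers\<close>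

lemma fermat_factorization: "(2::int) ^ 2 ^ Suc s - 1 = (2 ^ 2 ^ s + 1) * (2 ^ 2 ^ s - 1)"
  unfolding power_Suc2 power_mult by (simp add: algebra_simps power2_eq_square)

text \<open>Take a prime factor of the Fermat number 2^(2^s) + 1. It is odd, so modulo it 2^(2^s) is
  -1 and differs from 1, while its square is 1.\<close>

lemma ex_prime_ord_eq_power2: "\<exists>q :: nat. prime q \<and> ord q 2 = 2 ^ Suc s"
proof -
  have "(2::nat) ^ 2 ^ s + 1 \<noteq> 1" by simp
  then obtain q :: nat where q: "prime q" "q dvd 2 ^ 2 ^ s + 1" using prime_factor_nat by blast
  have "q \<noteq> 2" using q(2) by auto
  then have q3: "q > 2" using prime_ge_2_nat[OF q(1)] by simp
  have "(2::int) ^ 2 ^ Suc s - 1 = (2 ^ 2 ^ s + 1) * (2 ^ 2 ^ s - 1)"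
    by (rule fermat_factorization)
  moreover have iq: "int q dvd 2 ^ 2 ^ s + 1"
    using q(2) by (metis int_dvd_int_iff of_nat_1 of_nat_add of_nat_numeral of_nat_power)
  ultimately have "int q dvd 2 ^ 2 ^ Suc s - 1" by (metis dvd_mult2)
  then have "[2 ^ 2 ^ Suc s = 1] (mod int q)" by (simp add: cong_iff_dvd_diff)
  then have "[2 ^ 2 ^ Suc s = 1] (mod q)"
    by (metis cong_int_iff of_nat_1 of_nat_numeral of_nat_power)
  then have d: "ord q 2 dvd 2 ^ Suc s" by (simp only: ord_divides)
  have "\<not> ord q 2 dvd 2 ^ s"
  proof
    assume "ord q 2 dvd 2 ^ s"
    then have "[2 ^ 2 ^ s = 1] (mod q)" by (simp only: ord_divides)
    then have "[2 ^ 2 ^ s = 1] (mod int q)"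
      by (metis cong_int_iff of_nat_1 of_nat_numeral of_nat_power)
    then have "int q dvd 2 ^ 2 ^ s - 1" by (simp add: cong_iff_dvd_diff)
    then have "int q dvd (2 ^ 2 ^ s + 1) - (2 ^ 2 ^ s - 1)" using iq by (rule dvd_diff[rotated])
    then have "int q dvd 2" by simp
    then show False using q3 zdvd_imp_le[of "int q" 2] by simp
  qed
  moreover obtain i where i: "i \<le> Suc s" "ord q 2 = 2 ^ i"
    using d divides_primepow_nat[of 2 "ord q 2" "Suc s"] by auto
  ultimately have "\<not> i \<le> s" using le_imp_power_dvd by metis
  then have "i = Suc s" using i by simp
  then show ?thesis using q i by blast
qed

text \<open>Modulo the prime q, 2^(2^s) is a square root of 1 other than 1, hence -1, and an odd
  power of -1 is -1. Since 2^s is the exact power of 2 in d, one prime for each s < K deals with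
  every difference d not divisible by 2^K.\<close>

lemma dvd_power2_plus_1:
  fixes q d :: nat
  assumes q: "prime q" "ord q 2 = 2 ^ Suc s" and d: "d = 2 ^ s * k" "odd k"
  shows "q dvd 2 ^ d + 1"
proof -
  have "[2 ^ 2 ^ Suc s = 1] (mod q)" using q(2) ord[of 2 q] by metis
  then have "[2 ^ 2 ^ Suc s = 1] (mod int q)"
    by (metis cong_int_iff of_nat_1 of_nat_numeral of_nat_power)
  then have "int q dvd 2 ^ 2 ^ Suc s - 1" by (simp add: cong_iff_dvd_diff)
  also have "(2::int) ^ 2 ^ Suc s - 1 = (2 ^ 2 ^ s + 1) * (2 ^ 2 ^ s - 1)"
    by (rule fermat_factorization)
  finally have "int q dvd 2 ^ 2 ^ s + 1 \<or> int q dvd 2 ^ 2 ^ s - 1"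
    using q(1) by (simp add: prime_dvd_mult_iff)
  moreover have "\<not> int q dvd 2 ^ 2 ^ s - 1"
  proof
    assume "int q dvd 2 ^ 2 ^ s - 1"
    then have "[2 ^ 2 ^ s = 1] (mod int q)" by (simp add: cong_iff_dvd_diff)
    then have "[2 ^ 2 ^ s = 1] (mod q)"
      by (metis cong_int_iff of_nat_1 of_nat_numeral of_nat_power)
    then have "2 ^ Suc s dvd (2 ^ s :: nat)" using q(2) by (simp only: ord_divides)
    then show False by (simp add: dvd_power_iff)
  qed
  ultimately have "[2 ^ 2 ^ s = - 1] (mod int q)" by (simp add: cong_iff_dvd_diff)
  then have "[(2 ^ 2 ^ s) ^ k = (- 1) ^ k] (mod int q)" by (rule cong_pow)
  then have "int q dvd 2 ^ d + 1"
    using d by (simp add: cong_iff_dvd_diff power_mult)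
  then show ?thesis
    by (metis int_dvd_int_iff of_nat_1 of_nat_add of_nat_numeral of_nat_power)
qed

lemma sum_inverse_power2_le: "(\<Sum>s<K. 1 / 2 ^ Suc s) \<le> (1 :: real)"
proof -
  have "(\<Sum>s<K. 1 / 2 ^ Suc s) = 1 - (1 / 2 ^ K :: real)"
    by (induction K) auto
  then show ?thesis by simp
qed

text \<open>Modulo the prime of odd order m, r is 2^c + 2^(c + 2^K t), with c and t the greedy
  choices for m. When b = a + 2^K u and u equals t exactly, 2^a + 2^b is 2^a times a fixed factor,
  so a modulo m decides its residue and the pair is covered. The assumption L \<le> 2^K T forces u <
  T. Pairs with a = b are not lost by Crocker's step: they appear in the rectangle with u =
  0.\<close>

lemma ex_covering:
  fixes K L T J :: nat
  assumes T: "T > 0" and L: "L \<le> 2 ^ K * T"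
  defines "M \<equiv> 2 ^ Suc J"
  shows "\<exists>Q r. finite Q \<and> (\<forall>p\<in>Q. prime p \<and> odd p) \<and> card Q \<le> K + M \<and>
    \<Prod>Q \<le> 2 ^ (2 * 2 ^ K + M * M) \<and> (\<Prod>p\<in>Q. 1 + 1 / real p) \<le> exp (5 / 2 + 2 * harm J) \<and>
    real (card {(a, b). a < L \<and> b < L \<and> (\<forall>p\<in>Q. \<not> [r = 2 ^ a + 2 ^ b] (mod p))})
      \<le> 2 * real L * real T * exp ((2 - harm M / 4) / real T)"
proof -
  define Good where "Good = {m. odd m \<and> 9 \<le> m \<and> m \<le> M \<and> (\<Sum>l\<in>prime_factors m. 1 / real l) \<le> 1 / 2}"
  define Pow2 where "Pow2 = (\<lambda>s. 2 ^ Suc s :: nat) ` {..<K}"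
  define \<D> where "\<D> = Pow2 \<union> Good"
  define q where "q = (\<lambda>d. SOME q :: nat. prime q \<and> ord q 2 = d)"
  define Q where "Q = q ` \<D>"
  have Good: "finite Good" "Good \<subseteq> {1..M}" unfolding Good_def by auto
  have cardGood: "card Good \<le> M" using card_mono[OF _ Good(2)] by simp
  have Pow2: "finite Pow2" "card Pow2 \<le> K"
    unfolding Pow2_def using card_image_le[of "{..<K}" "\<lambda>s. 2 ^ Suc s :: nat"] by auto
  have injPow2: "inj_on (\<lambda>s. 2 ^ Suc s :: nat) {..<K}" by (auto simp: inj_on_def)
  have disj: "Pow2 \<inter> Good = {}" unfolding Pow2_def Good_def by auto
  have fin\<D>: "finite \<D>" unfolding \<D>_def using Good Pow2 by simp
  have q: "prime (q d) \<and> ord (q d) 2 = d" if "d \<in> \<D>" for d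
  proof -
    have "\<exists>q :: nat. prime q \<and> ord q 2 = d"
      using that ex_prime_ord_eq_power2 ex_prime_ord_eq[of d]
      unfolding \<D>_def Pow2_def Good_def by auto
    then show ?thesis unfolding q_def by (rule someI_ex)
  qed
  have dpos: "d > 0" if "d \<in> \<D>" for d using that unfolding \<D>_def Pow2_def Good_def by auto
  \<comment> \<open>By Fermat's little theorem d divides q d - 1, so q d exceeds d, which controls
    reciprocals; q d divides 2^d - 1, so it is at most 2^d, which controls the modulus.\<close>
  have q_props: "odd (q d)" "d < q d" "q d \<le> 2 ^ d" if "d \<in> \<D>" for d
  proof -
    have o: "ord (q d) 2 = d" and p: "prime (q d)" using q[OF that] by auto
    have cop: "coprime (q d) 2" using dpos[OF that] o ord_eq_0[of "q d" 2] by auto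
    then show "odd (q d)" by simp
    have "d dvd totient (q d)" using order_divides_totient[OF cop] o by simp
    then have "d dvd q d - 1" using p by (simp add: totient_prime)
    then have "d \<le> q d - 1" using prime_gt_1_nat[OF p] by (intro dvd_imp_le) auto
    then show "d < q d" using prime_gt_1_nat[OF p] by simp
    have "[2 ^ d = 1] (mod q d)" using ord[of 2 "q d"] o by simp
    then have "q d dvd 2 ^ d - 1" by (simp add: cong_altdef_nat)
    then have "q d \<le> 2 ^ d - 1" using one_less_power[of "2::nat" d] dpos[OF that] by (intro dvd_imp_le) auto
    then show "q d \<le> 2 ^ d" by simp
  qed
  have injq: "inj_on q \<D>" using q by (metis inj_onI)

  define U where "U = {..<L} \<times> {..<T}"
  have U: "finite U" "\<And>a u. (a, u) \<in> U \<Longrightarrow> u < T" unfolding U_def by auto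
  have Gpos: "\<And>m. m \<in> Good \<Longrightarrow> m > 0" unfolding Good_def by auto
  have "\<exists>c t. real (card {(a, u) \<in> U. \<forall>m\<in>Good. \<not> (u = t m \<and> [a = c m] (mod m))})
    \<le> real (card U) * (\<Prod>m\<in>Good. 1 - 1 / (real T * real m))"
    by (rule greedy_cover[where T = T]) (use U T Good(1) Gpos in auto)
  then obtain c t where ct: "real (card {(a, u) \<in> U. \<forall>m\<in>Good. \<not> (u = t m \<and> [a = c m] (mod m))})
    \<le> real (card U) * (\<Prod>m\<in>Good. 1 - 1 / (real T * real m))" by blast
  define W where "W = {(a, u) \<in> U. \<forall>m\<in>Good. \<not> (u = t m \<and> [a = c m] (mod m))}"
  have finW: "finite W" using U(1) unfolding W_def by (auto intro: finite_subset)
  have cardW: "real (card W) \<le> real L * real T * exp ((2 - harm M / 4) / real T)"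
  proof -
    have "(\<Prod>m\<in>Good. 1 - 1 / (real T * real m)) \<le> (\<Prod>m\<in>Good. exp (- (1 / (real T * real m))))"
    proof (rule prod_mono)
      fix m assume "m \<in> Good"
      then have "1 \<le> T * m" using T Gpos[of m] by (simp add: Suc_le_eq)
      then have "1 \<le> real T * real m" by (metis of_nat_1 of_nat_mono of_nat_mult)
      then show "0 \<le> 1 - 1 / (real T * real m) \<and> 1 - 1 / (real T * real m) \<le> exp (- (1 / (real T * real m)))"
        using exp_ge_add_one_self[of "- (1 / (real T * real m))"] by simp
    qed
    also have "\<dots> = exp (- ((\<Sum>m\<in>Good. 1 / real m) / real T))"
      using Good(1) by (simp add: exp_sum[symmetric] sum_negf sum_divide_distrib mult.commute)
    also have "\<dots> \<le> exp ((2 - harm M / 4) / real T)"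
    proof -
      have "- (\<Sum>m\<in>Good. 1 / real m) \<le> 2 - harm M / 4"
        using sum_good_orders_ge[of M] unfolding Good_def by simp
      then have "- (\<Sum>m\<in>Good. 1 / real m) / real T \<le> (2 - harm M / 4) / real T"
        by (intro divide_right_mono) auto
      then show ?thesis by simp
    qed
    finally have "real (card U) * (\<Prod>m\<in>Good. 1 - 1 / (real T * real m))
      \<le> real (card U) * exp ((2 - harm M / 4) / real T)"
      by (intro mult_left_mono) auto
    then show ?thesis using ct unfolding W_def by (simp add: U_def)
  qed

  define v where "v = (\<lambda>d. if d \<in> Good then 2 ^ c d + 2 ^ (c d + 2 ^ K * t d) else 0 :: nat)"
  have "\<forall>i\<in>\<D>. \<forall>j\<in>\<D>. i \<noteq> j \<longrightarrow> coprime (q i) (q j)"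
    using q injq by (metis inj_onD primes_coprime)
  then obtain r where r: "\<forall>d\<in>\<D>. [r = v d] (mod q d)"
    using chinese_remainder_nat[OF fin\<D>] by blast

  define V where "V = {(a, b). a < L \<and> b < L \<and> (\<forall>p\<in>Q. \<not> [r = 2 ^ a + 2 ^ b] (mod p))}"
  have key: "\<exists>u. (a, u) \<in> W \<and> b = a + 2 ^ K * u" if "(a, b) \<in> V" "a \<le> b" for a b
  proof -
    define d where "d = b - a"
    have b: "b = a + d" using that unfolding d_def by simp
    have h: "(2::nat) ^ a + 2 ^ b = 2 ^ a * (2 ^ d + 1)" unfolding b by (simp add: power_add algebra_simps)
    have unc: "\<not> [r = 2 ^ a + 2 ^ b] (mod q e)" if "e \<in> \<D>" for e
      using \<open>(a, b) \<in> V\<close> that unfolding V_def Q_def by auto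
    have "2 ^ K dvd d"
    proof (rule ccontr)
      assume nd: "\<not> 2 ^ K dvd d"
      then have "d \<noteq> 0" by (metis dvd_0_right)
      then obtain k where k: "d = 2 ^ multiplicity 2 d * k" "\<not> 2 dvd k"
        using multiplicity_decompose'[of d 2] by auto
      define s where "s = multiplicity 2 d"
      have "s < K"
      proof (rule ccontr)
        assume "\<not> s < K"
        then have "(2::nat) ^ K dvd 2 ^ s" by (simp add: le_imp_power_dvd)
        then show False using nd k(1) unfolding s_def by (metis dvd_mult2)
      qed
      then have e: "2 ^ Suc s \<in> \<D>" unfolding \<D>_def Pow2_def by auto
      have "q (2 ^ Suc s) dvd 2 ^ d + 1"
        using dvd_power2_plus_1[of "q (2 ^ Suc s)" s d k] q[OF e] k unfolding s_def by auto
      then have "q (2 ^ Suc s) dvd 2 ^ a + 2 ^ b" unfolding h by (rule dvd_mult)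
      then have "[2 ^ a + 2 ^ b = 0] (mod q (2 ^ Suc s))" by (simp add: cong_0_iff)
      moreover have "v (2 ^ Suc s) = 0" unfolding v_def Good_def by simp
      then have "[r = 0] (mod q (2 ^ Suc s))" using r e by metis
      ultimately show False using unc[OF e] by (metis cong_sym cong_trans)
    qed
    then obtain u where u: "d = 2 ^ K * u" by blast
    have "b < L" "a < L" using that unfolding V_def by auto
    then have "2 ^ K * u < 2 ^ K * T" using L u b by linarith
    then have "u < T" by simp
    have "\<not> (u = t m \<and> [a = c m] (mod m))" if m: "m \<in> Good" for m
    proof
      assume *: "u = t m \<and> [a = c m] (mod m)"
      have mD: "m \<in> \<D>" using m unfolding \<D>_def by simp
      have o: "ord (q m) 2 = m" using q[OF mD] by simp
      then have "coprime (q m) 2" using dpos[OF mD] ord_eq_0[of "q m" 2] by auto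
      then have "[2 ^ a = 2 ^ c m] (mod q m)"
        using order_divides_expdiff[of "q m" 2 a "c m"] * o by simp
      then have "[2 ^ a * (2 ^ d + 1) = 2 ^ c m * (2 ^ d + 1)] (mod q m)"
        by (rule cong_mult) simp
      moreover have "2 ^ c m * (2 ^ d + 1) = v m"
        unfolding v_def using m * u by (simp add: power_add algebra_simps)
      ultimately have "[2 ^ a + 2 ^ b = v m] (mod q m)" unfolding h by metis
      then show False using unc[OF mD] r mD by (metis cong_sym cong_trans)
    qed
    then have "(a, u) \<in> W" unfolding W_def U_def using \<open>a < L\<close> \<open>u < T\<close> by auto
    then show ?thesis using b u by blast
  qed
  \<comment> \<open>The rectangle only records pairs with a \<le> b; the reflected copy under
    \<open>g\<close> covers the others and causes the factor 2.\<close>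
  define f where "f = (\<lambda>(a :: nat, u). (a, a + 2 ^ K * u))"
  define g where "g = (\<lambda>(a :: nat, u). (a + 2 ^ K * u, a))"
  have "V \<subseteq> f ` W \<union> g ` W"
  proof
    fix x assume "x \<in> V"
    obtain a b where x: "x = (a, b)" by fastforce
    show "x \<in> f ` W \<union> g ` W"
    proof (cases "a \<le> b")
      case True
      then obtain u where "(a, u) \<in> W" "b = a + 2 ^ K * u" using key \<open>x \<in> V\<close> x by blast
      then have "x \<in> f ` W" unfolding x f_def by force
      then show ?thesis by simp
    next
      case False
      have "(b, a) \<in> V" using \<open>x \<in> V\<close> unfolding x V_def by (auto simp: add.commute)
      then obtain u where "(b, u) \<in> W" "a = b + 2 ^ K * u" using key False by (meson nat_le_linear)
      then have "x \<in> g ` W" unfolding x g_def by force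
      then show ?thesis by simp
    qed
  qed
  then have "card V \<le> card (f ` W \<union> g ` W)" using finW by (intro card_mono) auto
  also have "\<dots> \<le> card W + card W"
    using card_Un_le[of "f ` W" "g ` W"] card_image_le[OF finW, of f] card_image_le[OF finW, of g] by linarith
  finally have "real (card V) \<le> 2 * real (card W)" by linarith
  then have cardV: "real (card V) \<le> 2 * real L * real T * exp ((2 - harm M / 4) / real T)"
    using cardW by simp

  have "card Q \<le> card \<D>" unfolding Q_def using fin\<D> by (rule card_image_le)
  also have "\<dots> \<le> K + M" unfolding \<D>_def using card_Un_le[of Pow2 Good] Pow2 cardGood by linarith
  finally have cardQ: "card Q \<le> K + M" .

  have "\<Prod>Q = (\<Prod>d\<in>\<D>. q d)" unfolding Q_def using injq by (simp add: prod.reindex)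
  also have "\<dots> \<le> (\<Prod>d\<in>\<D>. 2 ^ d)" using q_props(3) by (intro prod_mono) auto
  also have "\<dots> = 2 ^ (\<Sum>d\<in>\<D>. d)" by (simp add: power_sum)
  also have "\<dots> \<le> 2 ^ (2 * 2 ^ K + M * M)"
  proof (rule power_increasing)
    have "(\<Sum>d\<in>\<D>. d) = (\<Sum>d\<in>Pow2. d) + (\<Sum>d\<in>Good. d)"
      unfolding \<D>_def using Pow2 Good disj by (intro sum.union_disjoint) auto
    also have "(\<Sum>d\<in>Pow2. d) = (\<Sum>s<K. 2 ^ Suc s)"
      unfolding Pow2_def using injPow2 by (simp add: sum.reindex)
    also have "\<dots> \<le> 2 * 2 ^ K" by (induction K) auto
    also have "(\<Sum>d\<in>Good. d) \<le> card Good * M"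
      using sum_bounded_above[of Good "\<lambda>d. d" M] by (simp add: Good_def)
    also have "\<dots> \<le> M * M" using cardGood by simp
    finally show "(\<Sum>d\<in>\<D>. d) \<le> 2 * 2 ^ K + M * M" by simp
  qed simp
  finally have prodQ: "\<Prod>Q \<le> 2 ^ (2 * 2 ^ K + M * M)" .

  have "(\<Prod>p\<in>Q. 1 + 1 / real p) = (\<Prod>d\<in>\<D>. 1 + 1 / real (q d))"
    unfolding Q_def using injq by (simp add: prod.reindex)
  also have "\<dots> \<le> (\<Prod>d\<in>\<D>. exp (1 / real (q d)))"
    by (intro prod_mono) (auto intro: exp_ge_add_one_self)
  also have "\<dots> = exp (\<Sum>d\<in>\<D>. 1 / real (q d))" using fin\<D> by (simp add: exp_sum)
  also have "(\<Sum>d\<in>\<D>. 1 / real (q d)) = (\<Sum>d\<in>Pow2. 1 / real (q d)) + (\<Sum>d\<in>Good. 1 / real (q d))"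
    unfolding \<D>_def using Pow2 Good disj by (intro sum.union_disjoint) auto
  also have "exp \<dots> \<le> exp (5 / 2 + 2 * harm J)"
  proof -
    have "(\<Sum>d\<in>Pow2. 1 / real (q d)) \<le> (\<Sum>d\<in>Pow2. 1 / real d)"
    proof (rule sum_mono)
      fix d assume "d \<in> Pow2"
      then have "d \<in> \<D>" unfolding \<D>_def by simp
      then show "1 / real (q d) \<le> 1 / real d" using dpos q_props(2)[of d] by (intro divide_left_mono) auto
    qed
    also have "\<dots> = (\<Sum>s<K. 1 / 2 ^ Suc s)" unfolding Pow2_def using injPow2 by (simp add: sum.reindex)
    also have "\<dots> \<le> 1" by (rule sum_inverse_power2_le)
    finally have 1: "(\<Sum>d\<in>Pow2. 1 / real (q d)) \<le> 1" .
    \<comment> \<open>Using only q d > d would allow a sum of order log M here, and its exponential,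
      a power of M, would swamp the covering. Instead the values q d \<le> M are distinct primes,
      and the at most M larger ones contribute at most 1 / M each.\<close>
    have "(\<Sum>d\<in>Good. 1 / real (q d)) \<le> (\<Sum>d\<in>Good. (if q d \<le> M then 1 / real (q d) else 0) + 1 / real M)"
    proof (rule sum_mono)
      fix d
      have "0 < M" unfolding M_def by simp
      then have "1 / real (q d) \<le> 1 / real M" if "M < q d"
        using that by (intro frac_le) auto
      then show "1 / real (q d) \<le> (if q d \<le> M then 1 / real (q d) else 0) + 1 / real M"
        by (auto simp: not_le)
    qed
    also have "\<dots> = (\<Sum>d | d \<in> Good \<and> q d \<le> M. 1 / real (q d)) + real (card Good) * (1 / real M)"
      using Good(1) by (simp add: sum.distrib sum.inter_filter)
    also have "(\<Sum>d | d \<in> Good \<and> q d \<le> M. 1 / real (q d)) = (\<Sum>p\<in>q ` {d \<in> Good. q d \<le> M}. 1 / real p)"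
    proof -
      have "inj_on q {d \<in> Good. q d \<le> M}" using injq by (rule inj_on_subset) (auto simp: \<D>_def)
      then show ?thesis by (simp add: sum.reindex)
    qed
    also have "\<dots> \<le> (\<Sum>p | prime p \<and> p \<le> M. 1 / real p)"
      using q unfolding \<D>_def by (intro sum_mono2) auto
    also have "\<dots> \<le> 1 / 2 + 2 * harm J" unfolding M_def by (rule sum_inverse_primes_le)
    also have "real (card Good) * (1 / real M) \<le> 1" using of_nat_mono[OF cardGood, where ?'a = real] by (simp add: divide_le_eq)
    finally have "(\<Sum>d\<in>Good. 1 / real (q d)) \<le> 1 / 2 + 2 * harm J + 1" by simp
    then show ?thesis using 1 by simp
  qed
  finally have sumQ: "(\<Prod>p\<in>Q. 1 + 1 / real p) \<le> exp (5 / 2 + 2 * harm J)" .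

  have "finite Q" "\<forall>p\<in>Q. prime p \<and> odd p"
    unfolding Q_def using fin\<D> q q_props(1) by auto
  then show ?thesis using cardQ prodQ sumQ cardV unfolding V_def by blast
qed

section \<open>Counting exceptions in an arithmetic progression\<close>

lemma card_less_cong_bounds:
  fixes d N j0 :: nat
  assumes "d > 0" "j0 < d"
  shows "\<bar>real (card {j. j < N \<and> [j = j0] (mod d)}) - real N / real d\<bar> \<le> 1"
proof -
  have eq: "{j. j < N \<and> [j = j0] (mod d)} = (\<lambda>i. j0 + d * i) ` {i. j0 + d * i < N}"
  proof -
    have "\<exists>i. j = j0 + d * i" if "[j = j0] (mod d)" for j
    proof -
      have "j mod d = j0" using that assms by (simp add: Cong.cong_def)
      then show ?thesis by (metis mod_mult_div_eq)
    qed
    moreover have "[j0 + d * i = j0] (mod d)" for i by (simp add: Cong.cong_def)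
    ultimately show ?thesis by auto
  qed
  have "inj_on (\<lambda>i. j0 + d * i) {i. j0 + d * i < N}" using assms by (auto simp: inj_on_def)
  then have c: "card {j. j < N \<and> [j = j0] (mod d)} = card {i. j0 + d * i < N}"
    unfolding eq by (rule card_image)
  have sub: "{i. j0 + d * i < N} \<subseteq> {..N div d}"
  proof
    fix i assume "i \<in> {i. j0 + d * i < N}"
    then have "d * i \<le> N" by simp
    then have "d * i div d \<le> N div d" by (rule div_le_mono)
    then show "i \<in> {..N div d}" using assms(1) by simp
  qed
  then have fin: "finite {i. j0 + d * i < N}" by (rule finite_subset) simp
  have "card {i. j0 + d * i < N} \<le> N div d + 1"
    using card_mono[OF _ sub] by simp
  moreover have "N div d \<le> card {i. j0 + d * i < N}"
  proof -
    have "j0 + d * i < N" if "i < N div d" for i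
    proof -
      have "d * (i + 1) \<le> d * (N div d)" using that by (intro mult_le_mono) auto
      also have "\<dots> \<le> N" by simp
      finally show ?thesis using assms by (simp add: algebra_simps)
    qed
    then have "{..<N div d} \<subseteq> {i. j0 + d * i < N}" by blast
    from card_mono[OF fin this] show ?thesis by simp
  qed
  moreover have "real (N div d) \<le> real N / real d" by (rule of_nat_div_le_of_nat)
  moreover have "real N / real d \<le> real (N div d) + 1"
  proof -
    have "N < d * (N div d + 1)" using assms by (simp add: dividend_less_times_div)
    then have "real N < real d * (real (N div d) + 1)"
      by (metis of_nat_1 of_nat_add of_nat_less_iff of_nat_mult)
    then show ?thesis using assms by (simp add: divide_le_eq mult.commute)
  qed
  ultimately show ?thesis unfolding c by linarith
qed

lemma card_dvd_progression:
  fixes d W B N :: nat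
  assumes "d > 0" "coprime d W"
  shows "\<bar>real (card {j \<in> {..<N}. d dvd B + W * j}) - real N / real d\<bar> \<le> 1"
proof -
  obtain u where u: "[W * u = 1] (mod d)"
    using assms(2) cong_solve_coprime_nat[of W d] by (auto simp: coprime_commute)
  define j0 where "j0 = (u * (d - B mod d)) mod d"
  have "[B + W * j = 0] (mod d) \<longleftrightarrow> [j = j0] (mod d)" for j
  proof -
    have "[B + W * j0 = 0] (mod d)"
    proof -
      have "[W * j0 = W * (u * (d - B mod d))] (mod d)"
        unfolding j0_def by (intro cong_mult) (auto simp: Cong.cong_def)
      also have "W * (u * (d - B mod d)) = W * u * (d - B mod d)" by (simp add: mult_ac)
      also have "[\<dots> = 1 * (d - B mod d)] (mod d)" by (intro cong_mult u cong_refl)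
      finally have "[B + W * j0 = B mod d + (d - B mod d)] (mod d)"
        by (intro cong_add) (auto simp: Cong.cong_def)
      moreover have "B mod d + (d - B mod d) = d" using assms(1) by (simp add: less_imp_le)
      ultimately show ?thesis by (simp add: Cong.cong_def)
    qed
    then have "[B + W * j = 0] (mod d) \<longleftrightarrow> [B + W * j = B + W * j0] (mod d)"
      by (metis cong_sym cong_trans)
    also have "\<dots> \<longleftrightarrow> [W * j = W * j0] (mod d)" by (rule cong_add_lcancel_nat)
    also have "\<dots> \<longleftrightarrow> [j = j0] (mod d)"
      by (rule cong_mult_lcancel_nat) (use assms(2) in \<open>simp add: coprime_commute\<close>)
    finally show ?thesis .
  qed
  then have "{j \<in> {..<N}. d dvd B + W * j} = {j. j < N \<and> [j = j0] (mod d)}"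
    by (auto simp: cong_0_iff)
  then show ?thesis using card_less_cong_bounds[of d j0 N] assms(1) unfolding j0_def by simp
qed

text \<open>The progression is fixed modulo the primes dividing W, so these must lie in Q and cannot
  sift; for any other prime, divisibility picks one residue class of j, which gives
  \<open>level\<close> with error 1. The harmonic sum then bounds G from below. The condition h
  \<le> A + W j keeps the subtraction of natural numbers genuine.\<close>

lemma sifted_progression_card_le:
  fixes Q :: "nat set" and A W N D h :: nat
  assumes Q: "finite Q" "\<And>p. p \<in> Q \<Longrightarrow> prime p" and D: "D > 0"
    and W: "\<And>p. prime p \<Longrightarrow> p dvd W \<Longrightarrow> p \<in> Q"
  defines "P \<equiv> {p. prime p \<and> p \<le> D \<and> p \<notin> Q}"
  shows "real (card {j \<in> {..<N}. h \<le> A + W * j \<and> (\<forall>p\<in>P. \<not> p dvd A + W * j - h)})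
    \<le> 2 * (\<Prod>p\<in>Q. 1 + 1 / real p) * real N / harm D + real D ^ 4"
proof -
  define Z where "Z = \<Prod>P"
  \<comment> \<open>congruent to \<open>A + W * j - h\<close> modulo \<open>Z\<close>, without the truncated subtraction\<close>
  define f where "f = (\<lambda>j. (A + h * (Z - 1)) + W * j)"
  have P: "finite P" "\<And>p. p \<in> P \<Longrightarrow> prime p" unfolding P_def by auto
  have Zpos: "Z > 0" unfolding Z_def using P by (intro prod_pos) (auto simp: prime_gt_0_nat)
  have f: "f j = (A + W * j - h) + h * Z" if "h \<le> A + W * j" for j
    using that Zpos by (cases Z) (auto simp: f_def)
  define G where "G = (\<Sum>S | S \<subseteq> P \<and> \<Prod>S \<le> D. 1 / (\<Prod>p\<in>S. real p - 1))"
  define E where "E = (\<Prod>p\<in>Q. 1 + 1 / real p)"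
  have E: "E > 0" unfolding E_def by (intro prod_pos) (auto intro: add_pos_nonneg)
  have harm: "harm D > (0 :: real)" using D by simp
  have "harm D \<le> 2 * E * (\<Sum>S | S \<subseteq> P \<and> \<Prod>S \<le> D. 1 / real (\<Prod>S))"
    unfolding E_def P_def by (rule harm_le_sum_squarefree[OF Q])
  also have "\<dots> \<le> 2 * E * G"
  proof (rule mult_left_mono)
    show "(\<Sum>S | S \<subseteq> P \<and> \<Prod>S \<le> D. 1 / real (\<Prod>S)) \<le> G"
      unfolding G_def
    proof (rule sum_mono)
      fix S assume "S \<in> {S. S \<subseteq> P \<and> \<Prod>S \<le> D}"
      then have S: "p \<ge> 2" if "p \<in> S" for p using that P(2) prime_ge_2_nat by blast
      have pos: "(\<Prod>p\<in>S. real p - 1) > 0" using S by (intro prod_pos) fastforce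
      have "(\<Prod>p\<in>S. real p - 1) \<le> (\<Prod>p\<in>S. real p)" using S by (intro prod_mono) fastforce
      then show "1 / real (\<Prod>S) \<le> 1 / (\<Prod>p\<in>S. real p - 1)"
        using pos by (intro frac_le) auto
    qed
  qed (use E in auto)
  finally have G: "harm D \<le> 2 * E * G" .
  then have Gpos: "G > 0" using harm E by (smt (verit) mult_nonneg_nonpos)
  have "{j \<in> {..<N}. h \<le> A + W * j \<and> (\<forall>p\<in>P. \<not> p dvd A + W * j - h)}
    \<subseteq> {j \<in> {..<N}. \<forall>p\<in>P. \<not> p dvd f j}"
  proof -
    have "p dvd A + W * j - h" if "h \<le> A + W * j" "p \<in> P" "p dvd f j" for p j
    proof -
      have "p dvd h * Z" unfolding Z_def using that(2) P(1) by (intro dvd_mult dvd_prodI) auto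
      then show ?thesis using that(3) f[OF that(1)] by (simp add: dvd_add_left_iff)
    qed
    then show ?thesis by blast
  qed
  then have "real (card {j \<in> {..<N}. h \<le> A + W * j \<and> (\<forall>p\<in>P. \<not> p dvd A + W * j - h)})
    \<le> real (card {j \<in> {..<N}. \<forall>p\<in>P. \<not> p dvd f j})"
    by (intro of_nat_mono card_mono) auto
  also have "\<dots> \<le> real N / G + real D ^ 4"
    unfolding G_def
  proof (rule selberg_sieve)
    fix S assume S: "S \<subseteq> P"
    show "\<bar>real (card {i \<in> {..<N}. \<Prod>S dvd f i}) - real N / real (\<Prod>S)\<bar> \<le> 1"
      unfolding f_def
    proof (rule card_dvd_progression)
      show "0 < \<Prod>S" using S P by (intro prod_pos) (auto simp: prime_gt_0_nat)
      show "coprime (\<Prod>S) W"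
      proof (rule prod_coprime_left)
        fix p assume "p \<in> S"
        then have "prime p" "p \<notin> Q" using S unfolding P_def by auto
        then show "coprime p W" using W by (intro prime_imp_coprime) auto
      qed
    qed
  qed (use P D in auto)
  also have "real N / G \<le> 2 * E * real N / harm D"
  proof -
    have "harm D * real N \<le> 2 * E * G * real N" using G by (intro mult_right_mono) auto
    then show ?thesis using Gpos harm by (simp add: field_simps)
  qed
  finally show ?thesis unfolding E_def by simp
qed

text \<open>Let n = p^k + 2^a + 2^b lie in the class with p > D outside Q. If r were 2^a + 2^b
  modulo some q in Q, then q would divide p^k and equal p; so (a, b) lies in V. Moreover p^k has no
  prime factor up to D, so the sieve treats all exponents k at once. Representations with p \<le> D
  or p in Q are simply counted by their parameters (p, k, a, b).\<close>

lemma ex_progression_few_representable: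
  fixes Q :: "nat set" and r L N D :: nat
  assumes Q: "finite Q" "\<And>p. p \<in> Q \<Longrightarrow> prime p" "\<And>p. p \<in> Q \<Longrightarrow> odd p" and D: "D > 0"
    and L: "2 * \<Prod>Q * N \<le> 2 ^ L"
  defines "V \<equiv> {(a, b). a < L \<and> b < L \<and> (\<forall>p\<in>Q. \<not> [r = 2 ^ a + 2 ^ b] (mod p))}"
  shows "\<exists>A < 2 * \<Prod>Q. real (card {j \<in> {..<N}. A + 2 * \<Prod>Q * j \<notin> N_star}) \<le>
    real (card V) * (3 * (\<Prod>p\<in>Q. 1 + 1 / real p) * real N / harm D + real D ^ 4)
      + (real D + real (card Q)) * real L ^ 3"
proof -
  define W where "W = 2 * \<Prod>Q"
  \<comment> \<open>The prime 2 joins the modulus to make every n odd, hence it also leaves the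
    sieve; its factor 1 + 1/2 turns the constant 2 of the sieve bound into 3.\<close>
  define Q2 where "Q2 = insert 2 Q"
  have "2 \<notin> Q" using Q(3)[of 2] by auto
  then have Q2: "finite Q2" "\<And>p. p \<in> Q2 \<Longrightarrow> prime p" "2 \<notin> Q" unfolding Q2_def using Q by auto
  have prodQ2: "\<Prod>Q2 = W" unfolding Q2_def W_def using Q2(3) Q(1) by simp
  have Wpos: "W > 0" unfolding W_def using Q by (auto intro!: prod_pos simp: prime_gt_0_nat)
  have "\<forall>i\<in>Q2. \<forall>j\<in>Q2. i \<noteq> j \<longrightarrow> coprime i j" using Q2(2) by (auto intro: primes_coprime)
  then obtain y where y: "\<forall>p\<in>Q2. [y = (if p = 2 then 1 else r)] (mod p)"
    using chinese_remainder_nat[OF Q2(1), of "\<lambda>p. p" "\<lambda>p. if p = 2 then 1 else r"] by blast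
  define A where "A = y mod W"
  define n where "n = (\<lambda>j. A + W * j)"
  have n_cong: "[n j = (if p = 2 then 1 else r)] (mod p)" if "p \<in> Q2" for p j
  proof -
    have "p dvd W" unfolding prodQ2[symmetric] using that Q2(1) by (intro dvd_prodI) auto
    then have "[n j = y] (mod p)"
      unfolding n_def A_def Cong.cong_def by (metis mod_mod_cancel mod_mult_self2)
    then show ?thesis using y that cong_trans by blast
  qed
  have n_odd: "odd (n j)" for j
    using n_cong[of 2 j] unfolding Q2_def by (auto simp: Cong.cong_def odd_iff_mod_2_eq_one)
  have n_less: "n j < 2 ^ L" if "j < N" for j
  proof -
    have "n j < W + W * j" unfolding n_def A_def using Wpos by simp
    also have "\<dots> \<le> W * N" using that by (metis Suc_leI mult_Suc_right mult_le_mono2)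
    finally show ?thesis using L unfolding W_def by simp
  qed
  define P where "P = {p. prime p \<and> p \<le> D \<and> p \<notin> Q2}"
  define J where "J = (\<lambda>(a :: nat, b :: nat). {j \<in> {..<N}. 2 ^ a + 2 ^ b \<le> n j \<and> (\<forall>p\<in>P. \<not> p dvd n j - (2 ^ a + 2 ^ b))})"
  define R where "R = ({1..D} \<union> Q) \<times> ({..<L} \<times> ({..<L} \<times> {..<L}))"
  define g where "g = (\<lambda>(p, k, a, b). p ^ k + 2 ^ a + 2 ^ b :: nat)"
  define S where "S = {j \<in> {..<N}. n j \<in> g ` R}"
  have finV: "finite V" unfolding V_def by (rule finite_subset[of _ "{..<L} \<times> {..<L}"]) auto
  have finR: "finite R" unfolding R_def using Q by simp
  have "{j \<in> {..<N}. n j \<notin> N_star} \<subseteq> (\<Union>v\<in>V. J v) \<union> S"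
  proof
    fix j assume "j \<in> {j \<in> {..<N}. n j \<notin> N_star}"
    then have j: "j < N" "n j \<notin> N_star" by auto
    have "1 \<le> n j" using odd_pos[OF n_odd[of j]] by simp
    then obtain p k a b where rep: "prime p" "k \<ge> 1" "n j = p ^ k + 2 ^ a + 2 ^ b"
      using j(2) n_odd[of j] unfolding N_star_def by auto
    have lt: "a < L" "b < L" "k < L"
    proof -
      have "(2::nat) ^ a < 2 ^ L" "(2::nat) ^ b < 2 ^ L" "p ^ k < 2 ^ L" using n_less[OF j(1)] rep(3) by linarith+
      moreover have "2 ^ k \<le> p ^ k" using rep(1) prime_ge_2_nat by (intro power_mono) auto
      then have "(2::nat) ^ k < 2 ^ L" using \<open>p ^ k < 2 ^ L\<close> by (rule le_less_trans)
      ultimately show "a < L" "b < L" "k < L" by simp_all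
    qed
    show "j \<in> (\<Union>v\<in>V. J v) \<union> S"
    proof (cases "p \<in> {1..D} \<union> Q")
      case True
      then have "(p, k, a, b) \<in> R" using lt unfolding R_def by simp
      moreover have "n j = g (p, k, a, b)" unfolding g_def rep(3) by simp
      ultimately have "n j \<in> g ` R" by (rule rev_image_eqI)
      then show ?thesis using j unfolding S_def by simp
    next
      case False
      then have pD: "p > D" "p \<notin> Q" using prime_gt_0_nat[OF rep(1)] by auto
      have "\<not> [r = 2 ^ a + 2 ^ b] (mod q)" if q: "q \<in> Q" for q
      proof
        assume "[r = 2 ^ a + 2 ^ b] (mod q)"
        moreover have "[n j = r] (mod q)" using n_cong[of q j] q Q2(3) unfolding Q2_def by (auto split: if_splits)
        ultimately have "[p ^ k + (2 ^ a + 2 ^ b) = 0 + (2 ^ a + 2 ^ b)] (mod q)"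
          unfolding rep(3) by (metis add.assoc add_0 cong_trans)
        then have "[p ^ k = 0] (mod q)" by (simp only: cong_add_rcancel_nat)
        then have "q dvd p ^ k" by (simp add: cong_0_iff)
        then have "q = p" using Q(2)[OF q] rep(1) by (metis prime_dvd_power primes_dvd_imp_eq)
        then show False using pD q by simp
      qed
      then have "(a, b) \<in> V" using lt unfolding V_def by simp
      moreover have "\<not> q dvd n j - (2 ^ a + 2 ^ b)" if q: "q \<in> P" for q
      proof
        assume "q dvd n j - (2 ^ a + 2 ^ b)"
        then have "q dvd p ^ k" unfolding rep(3) by simp
        moreover have "prime q" "q \<le> D" using q unfolding P_def by auto
        ultimately have "q = p" using rep(1) by (metis prime_dvd_power primes_dvd_imp_eq)
        then show False using pD \<open>q \<le> D\<close> by simp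
      qed
      then have "j \<in> J (a, b)" using j rep(3) unfolding J_def by auto
      ultimately show ?thesis by blast
    qed
  qed
  then have "card {j \<in> {..<N}. n j \<notin> N_star} \<le> card ((\<Union>v\<in>V. J v) \<union> S)"
    using finV by (intro card_mono) (auto simp: J_def S_def)
  also have "\<dots> \<le> card (\<Union>v\<in>V. J v) + card S" by (rule card_Un_le)
  also have "\<dots> \<le> (\<Sum>v\<in>V. card (J v)) + card S" using card_UN_le[OF finV, of J] by simp
  finally have "real (card {j \<in> {..<N}. n j \<notin> N_star}) \<le> (\<Sum>v\<in>V. real (card (J v))) + real (card S)"
    by (metis of_nat_add of_nat_mono of_nat_sum)
  also have "(\<Sum>v\<in>V. real (card (J v))) \<le> (\<Sum>v\<in>V. 3 * (\<Prod>p\<in>Q. 1 + 1 / real p) * real N / harm D + real D ^ 4)"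
  proof (rule sum_mono)
    fix v
    obtain a b :: nat where v: "v = (a, b)" by fastforce
    have "p \<in> Q2" if "prime p" "p dvd W" for p
      using that prime_dvd_prod_iff[OF Q2(1) that(1), of "\<lambda>p. p"] Q2(2) primes_dvd_imp_eq
      unfolding prodQ2[symmetric] by blast
    then have "real (card (J v)) \<le> 2 * (\<Prod>p\<in>Q2. 1 + 1 / real p) * real N / harm D + real D ^ 4"
      unfolding J_def v n_def P_def prod.case
      using sifted_progression_card_le[OF Q2(1,2) D] by blast
    also have "(\<Prod>p\<in>Q2. 1 + 1 / real p) = 3 / 2 * (\<Prod>p\<in>Q. 1 + 1 / real p)"
      unfolding Q2_def using Q2(3) Q(1) by simp
    finally show "real (card (J v)) \<le> 3 * (\<Prod>p\<in>Q. 1 + 1 / real p) * real N / harm D + real D ^ 4"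
      by simp
  qed
  also have "\<dots> = real (card V) * (3 * (\<Prod>p\<in>Q. 1 + 1 / real p) * real N / harm D + real D ^ 4)"
    by simp
  also have "real (card S) \<le> (real D + real (card Q)) * real L ^ 3"
  proof -
    have "inj_on n S" unfolding n_def using Wpos by (auto simp: inj_on_def)
    then have "card S = card (n ` S)" by (simp add: card_image)
    also have "\<dots> \<le> card (g ` R)" using finR by (intro card_mono) (auto simp: S_def)
    also have "\<dots> \<le> card R" using finR by (rule card_image_le)
    also have "\<dots> = card ({1..D} \<union> Q) * L ^ 3" unfolding R_def by (simp add: card_cartesian_product power3_eq_cube)
    also have "\<dots> \<le> (D + card Q) * L ^ 3" using card_Un_le[of "{1..D}" Q] by (intro mult_right_mono) auto
    finally have "real (card S) \<le> real ((D + card Q) * L ^ 3)" by (rule of_nat_mono)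
    then show ?thesis by simp
  qed
  finally have "real (card {j \<in> {..<N}. n j \<notin> N_star}) \<le>
    real (card V) * (3 * (\<Prod>p\<in>Q. 1 + 1 / real p) * real N / harm D + real D ^ 4)
      + (real D + real (card Q)) * real L ^ 3" by simp
  moreover have "A < 2 * \<Prod>Q" unfolding A_def using Wpos W_def by simp
  ultimately show ?thesis unfolding n_def W_def by blast
qed

section \<open>Choice of parameters: covering and sieve against the size of the modulus\<close>

lemma harm_le_ln: "n > 0 \<Longrightarrow> harm n \<le> 1 + ln (real n)"
proof (induction n rule: nat_induct_non_zero)
  case 1
  then show ?case by (simp add: harm_def)
next
  case (Suc n)
  have "ln (1 - 1 / real (Suc n)) \<le> - (1 / real (Suc n))"
    using ln_le_minus_one[of "1 - 1 / real (Suc n)"] Suc(1) by simp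
  moreover have "1 - 1 / real (Suc n) = real n / real (Suc n)" by (simp add: field_simps)
  then have "ln (1 - 1 / real (Suc n)) = ln (real n) - ln (real (Suc n))"
    using Suc(1) by (simp add: ln_div)
  ultimately show ?case using Suc(2) by (simp add: harm_Suc inverse_eq_divide)
qed

text \<open>At least half of the progression is exceptional once main term and error term are each
  at most N / 4. Here 960 = 4 * 2 * 3 * 40: the 4 from N / 4, the 2 from the size of V, the 3 from
  the sieve, and the 40 from harm D \<ge> L / 40. The bound 24 \<le> T makes W at most 2^(L/4), so N
  is at least 2^(L/2), which \<open>big\<close> compares with the error term.\<close>

lemma card_N_star_ge:
  fixes J L T :: nat and x :: real
  defines "M \<equiv> 2 ^ Suc J"
  assumes T: "24 \<le> T" "T \<le> M" and L: "M ^ 8 \<le> L" "100 \<le> L"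
    and small: "960 * real T * exp ((2 - harm M / 4) / real T + (5 / 2 + 2 * harm J)) \<le> 1"
    and big: "20 * real L ^ 4 * 2 powr (real L / 5) \<le> 2 powr (real L / 2)"
    and x: "2 powr (real L - 1) \<le> x" "x < 2 powr real L"
  shows "x / 4 * 2 powr (- (6 * real L / real T)) \<le> real (card {n \<in> N_star. 1 \<le> real n \<and> real n \<le> x})"
proof -
  have M1: "1 \<le> M" unfolding M_def by simp
  then have M_le: "M \<le> L" "M * M * M \<le> L"
    using L(1) power_increasing[of 1 8 M] power_increasing[of 3 8 M] by (simp_all add: power3_eq_cube)
  have Tpos: "T > 0" using T by simp
  have exK: "\<exists>K. L \<le> 2 ^ K * T"
  proof
    have "L \<le> 2 ^ L" by (simp add: less_imp_le less_exp)
    also have "\<dots> \<le> 2 ^ L * T" using Tpos by simp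
    finally show "L \<le> 2 ^ L * T" .
  qed
  \<comment> \<open>Minimality puts 2^K between L / T and 2 L / T: large enough for the rectangle to
    have height T, small enough for W.\<close>
  define K where "K = (LEAST K. L \<le> 2 ^ K * T)"
  have K: "L \<le> 2 ^ K * T" unfolding K_def using exK by (rule LeastI_ex)
  have K2: "2 ^ K * T \<le> 2 * L"
  proof (cases K)
    case 0
    then show ?thesis using T M_le by simp
  next
    case (Suc k)
    then have "\<not> L \<le> 2 ^ k * T" using not_less_Least[of k "\<lambda>K. L \<le> 2 ^ K * T"] unfolding K_def by simp
    then show ?thesis unfolding Suc by simp
  qed
  obtain Q r where Q: "finite Q" "\<forall>p\<in>Q. prime p \<and> odd p" "card Q \<le> K + M"
    "\<Prod>Q \<le> 2 ^ (2 * 2 ^ K + M * M)" "(\<Prod>p\<in>Q. 1 + 1 / real p) \<le> exp (5 / 2 + 2 * harm J)"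
    "real (card {(a, b). a < L \<and> b < L \<and> (\<forall>p\<in>Q. \<not> [r = 2 ^ a + 2 ^ b] (mod p))})
      \<le> 2 * real L * real T * exp ((2 - harm M / 4) / real T)"
    using ex_covering[OF Tpos K, of J] unfolding M_def by blast
  define V where "V = {(a, b). a < L \<and> b < L \<and> (\<forall>p\<in>Q. \<not> [r = 2 ^ a + 2 ^ b] (mod p))}"
  define E where "E = (\<Prod>p\<in>Q. 1 + 1 / real p)"
  define W where "W = 2 * \<Prod>Q"
  have Wpos: "W > 0" unfolding W_def using Q(1,2) by (auto intro!: prod_pos simp: prime_gt_0_nat)
  have W_le: "real W \<le> 2 powr (6 * real L / real T)"
  proof -
    \<comment> \<open>After multiplication by T, the powers of two give at most 4 L, the odd orders
      M * M * T \<le> M^3 \<le> L, and the factor 2 of W gives T \<le> L: hence the 6.\<close>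
    define e where "e = 1 + 2 * 2 ^ K + M * M"
    have "W \<le> 2 ^ e" unfolding W_def e_def using Q(4) by simp
    then have "real W \<le> 2 powr real e"
      by (metis of_nat_mono of_nat_numeral of_nat_power powr_realpow zero_less_numeral)
    also have "\<dots> \<le> 2 powr (6 * real L / real T)"
    proof (rule powr_mono)
      have "e * T = T + 2 * (2 ^ K * T) + M * M * T" unfolding e_def by (simp add: algebra_simps)
      also have "\<dots> \<le> L + 2 * (2 * L) + L"
      proof (intro add_mono)
        show "T \<le> L" using T(2) M_le(1) by simp
        show "2 * (2 ^ K * T) \<le> 2 * (2 * L)" by (intro mult_left_mono K2) simp
        have "M * M * T \<le> M * M * M" using T(2) by simp
        then show "M * M * T \<le> L" using M_le(2) by (rule order_trans)
      qed
      finally have "e * T \<le> 6 * L" by simp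
      then have "real e * real T \<le> 6 * real L" by (metis of_nat_mono of_nat_mult of_nat_numeral)
      then show "real e \<le> 6 * real L / real T" using Tpos by (simp add: pos_le_divide_eq)
    qed simp
    finally show ?thesis .
  qed
  have xpos: "x > 0" by (rule less_le_trans[OF _ x(1)]) simp
  have xW: "2 * 2 powr (real L / 2) \<le> x / real W"
  proof -
    have "6 * real L / real T \<le> 6 * real L / 24" using T by (intro divide_left_mono) auto
    then have "1 + real L / 2 + 6 * real L / real T \<le> real L - 1" using L(2) by simp
    then have "2 powr (1 + real L / 2 + 6 * real L / real T) \<le> x"
      using x(1) by (meson order_trans powr_mono one_le_numeral)
    then have "2 * 2 powr (real L / 2) * 2 powr (6 * real L / real T) \<le> x"
      by (simp add: powr_add)
    moreover have "2 * 2 powr (real L / 2) * real W \<le> 2 * 2 powr (real L / 2) * 2 powr (6 * real L / real T)"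
      using W_le by (intro mult_left_mono) auto
    ultimately have "2 * 2 powr (real L / 2) * real W \<le> x" by (rule order_trans[rotated])
    then show ?thesis using Wpos by (simp add: pos_le_divide_eq)
  qed
  define N where "N = nat \<lfloor>x / real W\<rfloor>"
  have p1: "1 \<le> 2 powr (real L / 2)" by (rule ge_one_powr_ge_zero) auto
  have N: "real N \<le> x / real W" "x / real W < real N + 1"
    unfolding N_def using xpos Wpos by (auto simp: of_nat_nat zero_le_divide_iff)
  have N_ge: "x / (2 * real W) \<le> real N" "2 powr (real L / 2) \<le> real N"
    using N(2) xW p1 by auto
  have WNx: "real W * real N \<le> x" using N(1) Wpos by (simp add: pos_le_divide_eq mult.commute)
  then have "real (W * N) < real (2 ^ L)" using x(2) by (simp add: powr_realpow)
  then have WN: "2 * \<Prod>Q * N \<le> 2 ^ L" unfolding W_def by (simp only: of_nat_less_iff)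
  \<comment> \<open>D has to be a fixed power of 2^L for harm D to be of order L, yet D^4 \<le>
    2^(L/5) must stay well below N.\<close>
  define D :: nat where "D = 2 ^ (L div 20)"
  have Dpos: "D > 0" unfolding D_def by simp
  have harmD: "real L / 40 \<le> harm D"
  proof -
    have "real L / 40 \<le> (real L / 20 - 1) * (2 / 3)" using L(2) by simp
    also have "\<dots> \<le> real (L div 20) * ln 2"
    proof (intro mult_mono ln2_ge_two_thirds)
      show "real L / 20 - 1 \<le> real (L div 20)" by linarith
    qed auto
    also have "\<dots> = ln (real D)" unfolding D_def by (simp add: ln_realpow)
    also have "\<dots> \<le> ln (real D + 1)" using Dpos by simp
    also have "\<dots> \<le> harm D" by (rule harm_ge_ln)
    finally show ?thesis .
  qed
  have D4: "real D ^ 4 \<le> 2 powr (real L / 5)"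
  proof -
    have "real D ^ 4 = 2 ^ (L div 20 * 4)"
      unfolding D_def by (simp add: power_mult)
    also have "\<dots> = 2 powr real (L div 20 * 4)" by (rule powr_realpow[symmetric]) simp
    also have "\<dots> \<le> 2 powr (real L / 5)" by (rule powr_mono) (linarith, simp)
    finally show ?thesis .
  qed
  obtain A where A: "A < W" "real (card {j \<in> {..<N}. A + W * j \<notin> N_star}) \<le>
    real (card V) * (3 * E * real N / harm D + real D ^ 4) + (real D + real (card Q)) * real L ^ 3"
    using ex_progression_few_representable[OF Q(1) _ _ Dpos WN, of r] Q(2) unfolding V_def E_def W_def by blast
  have "real (card V) * (3 * E * real N / harm D) \<le> real N / 4"
  proof -
    define e1 where "e1 = exp ((2 - harm M / 4) / real T)"
    define e2 where "e2 = exp (5 / 2 + 2 * harm J :: real)"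
    have Lpos: "real L > 0" using L(2) by simp
    have "3 * E * real N / harm D \<le> 3 * e2 * real N / (real L / 40)"
      using Q(5) harmD Lpos unfolding E_def e2_def
      by (intro frac_le mult_right_mono mult_left_mono) (auto intro: less_le_trans)
    then have "real (card V) * (3 * E * real N / harm D) \<le>
      (2 * real L * real T * e1) * (3 * e2 * real N / (real L / 40))"
      using Q(6) harmD Lpos Dpos unfolding V_def e1_def E_def
      by (intro mult_mono) (auto intro!: divide_nonneg_pos mult_nonneg_nonneg prod_nonneg)
    also have "\<dots> = (960 * real T * (e1 * e2)) * (real N / 4)"
      using Lpos by (simp add: field_simps)
    also have "\<dots> \<le> 1 * (real N / 4)"
      using small unfolding e1_def e2_def exp_add by (intro mult_right_mono) auto
    finally show ?thesis by simp
  qed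
  moreover have "real (card V) * real D ^ 4 + (real D + real (card Q)) * real L ^ 3 \<le> real N / 4"
  proof -
    have L1: "1 \<le> real L" and D1: "1 \<le> real D" using L(2) Dpos by auto
    have "card V \<le> card ({..<L} \<times> {..<L})" by (rule card_mono) (auto simp: V_def)
    then have V2: "real (card V) \<le> real L ^ 2"
      by (simp add: card_cartesian_product power2_eq_square flip: of_nat_mult)
    have "K < 2 ^ K" by (rule less_exp)
    also have "\<dots> \<le> 2 ^ K * T" using Tpos by simp
    finally have Q3: "real (card Q) \<le> 3 * real L" using Q(3) K2 M_le(1) by linarith
    have DD: "real D \<le> real D ^ 4" using power_increasing[of 1 4 "real D"] D1 by simp
    have "real (card V) * real D ^ 4 + (real D + real (card Q)) * real L ^ 3
      \<le> real L ^ 4 * real D ^ 4 + (real D ^ 4 * real L + 3 * real L * real D ^ 4) * real L ^ 3"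
    proof (intro add_mono mult_right_mono)
      show "real (card V) \<le> real L ^ 4" by (rule order_trans[OF V2]) (rule power_increasing[OF _ L1], simp)
      show "real D \<le> real D ^ 4 * real L" using mult_mono[OF DD L1] by simp
      have "3 * real L * 1 \<le> 3 * real L * real D ^ 4" using D1 DD by (intro mult_left_mono) auto
      then show "real (card Q) \<le> 3 * real L * real D ^ 4" using Q3 by simp
    qed auto
    also have "\<dots> = 5 * real L ^ 4 * real D ^ 4" by (simp add: algebra_simps power4_eq_xxxx power3_eq_cube)
    also have "\<dots> \<le> 5 * real L ^ 4 * 2 powr (real L / 5)" using D4 by (intro mult_left_mono) auto
    also have "\<dots> \<le> 2 powr (real L / 2) / 4" using big by simp
    also have "\<dots> \<le> real N / 4" using N_ge(2) by simp
    finally show ?thesis .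
  qed
  ultimately have bad: "real (card {j \<in> {..<N}. A + W * j \<notin> N_star}) \<le> real N / 2"
    using A(2) by (simp add: distrib_left)
  define Y where "Y = {j \<in> {..<N}. A + W * j \<in> N_star}"
  have "card {..<N} = card (Y \<union> {j \<in> {..<N}. A + W * j \<notin> N_star})"
    by (rule arg_cong[where f = card]) (auto simp: Y_def)
  also have "\<dots> \<le> card Y + card {j \<in> {..<N}. A + W * j \<notin> N_star}" by (rule card_Un_le)
  finally have "real N / 2 \<le> real (card Y)" using bad by simp
  moreover have "card Y \<le> card {n \<in> N_star. 1 \<le> real n \<and> real n \<le> x}"
  proof -
    have "inj_on (\<lambda>j. A + W * j) Y" using Wpos by (auto simp: inj_on_def)
    moreover have "(\<lambda>j. A + W * j) ` Y \<subseteq> {n \<in> N_star. 1 \<le> real n \<and> real n \<le> x}"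
    proof
      fix n assume "n \<in> (\<lambda>j. A + W * j) ` Y"
      then obtain j where j: "j < N" "n \<in> N_star" "n = A + W * j" unfolding Y_def by auto
      have "n \<le> W + W * j" using A(1) j(3) by simp
      also have "\<dots> \<le> W * N" using j(1) by (metis Suc_leI mult_Suc_right mult_le_mono2)
      finally have "real n \<le> real W * real N" by (metis of_nat_mono of_nat_mult)
      moreover have "1 \<le> n" using j(2) unfolding N_star_def by simp
      ultimately show "n \<in> {n \<in> N_star. 1 \<le> real n \<and> real n \<le> x}" using WNx j(2) by simp
    qed
    moreover have "finite {n \<in> N_star. 1 \<le> real n \<and> real n \<le> x}"
      by (rule finite_subset[of _ "{..nat \<lfloor>x\<rfloor>}"]) (auto simp: le_nat_iff le_floor_iff)
    ultimately show ?thesis using card_inj_on_le by blast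
  qed
  moreover have "x / 4 * 2 powr (- (6 * real L / real T)) \<le> real N / 2"
  proof -
    have "2 powr (- (6 * real L / real T)) \<le> 1 / real W"
      using W_le Wpos by (simp add: powr_minus_divide frac_le)
    then have "x / 4 * 2 powr (- (6 * real L / real T)) \<le> x / 4 * (1 / real W)"
      using xpos by (intro mult_left_mono) auto
    also have "\<dots> \<le> real N / 2" using N_ge(1) by simp
    finally show ?thesis .
  qed
  ultimately show ?thesis by simp
qed

theorem theorem1:
  shows "\<exists>C c x0 :: real. C > 0 \<and> c > 0 \<and> x0 > exp (exp (exp 1)) \<and>
    (\<forall>x \<ge> x0. real (card {n \<in> N_star. 1 \<le> real n \<and> real n \<le> x})
       \<ge> c * x * exp (- C * ln x * (ln (ln (ln (ln x))) / ln (ln (ln x)))))"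
proof -
  \<comment> \<open>A smooth lower bound for the integer J chosen below: B loses at most 1 against
    ln (ln x), and J at most 2 against B / 8.\<close>
  define u :: "real \<Rightarrow> real" where "u = (\<lambda>x. (ln (ln x) - 1) / 8 - 2)"
  \<comment> \<open>This is the condition \<open>small\<close> at y = J, with harm M replaced by the
    smaller J / 2 and T by the larger 2 ln J. From y = 16 on, 2 - y / 8 is nonpositive, so enlarging
    the denominator increases the quotient, as an upper bound requires.\<close>
  have "eventually (\<lambda>y :: real. 1920 * ln y * exp ((2 - y / 8) / (2 * ln y) + (5 / 2 + 2 * (1 + ln y))) \<le> 1) at_top"
    by real_asymp
  moreover have "eventually (\<lambda>y :: real. y \<ge> 16) at_top" by real_asymp
  ultimately have "eventually (\<lambda>y :: real. y \<ge> 16 \<and>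
      1920 * ln y * exp ((2 - y / 8) / (2 * ln y) + (5 / 2 + 2 * (1 + ln y))) \<le> 1) at_top"
    by eventually_elim simp
  then obtain y0 where y0: "\<And>y :: real. y \<ge> y0 \<Longrightarrow> y \<ge> 16 \<and>
      1920 * ln y * exp ((2 - y / 8) / (2 * ln y) + (5 / 2 + 2 * (1 + ln y))) \<le> 1"
    unfolding eventually_at_top_linorder by blast
  have "eventually (\<lambda>l :: real. 20 * l ^ 4 * 2 powr (l / 5) \<le> 2 powr (l / 2)) at_top"
    by real_asymp
  then obtain l0 where l0: "\<And>l :: real. l \<ge> l0 \<Longrightarrow> 20 * l ^ 4 * 2 powr (l / 5) \<le> 2 powr (l / 2)"
    unfolding eventually_at_top_linorder by blast
  have "eventually (\<lambda>x :: real. u x \<ge> y0) at_top" "eventually (\<lambda>x :: real. ln x \<ge> max l0 100) at_top"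
    "eventually (\<lambda>x :: real. ln (u x) - 1 \<ge> 24) at_top"
    "eventually (\<lambda>x :: real. ln (u x) - 1 \<ge> ln (ln (ln x)) / 2) at_top"
    "eventually (\<lambda>x :: real. ln (ln (ln (ln x))) \<ge> 1) at_top"
    "eventually (\<lambda>x :: real. ln (ln (ln x)) \<ge> 1) at_top"
    unfolding u_def by real_asymp+
  then have "eventually (\<lambda>x :: real. u x \<ge> y0 \<and> ln x \<ge> max l0 100 \<and> ln (u x) - 1 \<ge> 24 \<and>
      ln (u x) - 1 \<ge> ln (ln (ln x)) / 2 \<and> ln (ln (ln (ln x))) \<ge> 1 \<and> ln (ln (ln x)) \<ge> 1) at_top"
    by eventually_elim simp
  then obtain x1 where x1: "\<And>x :: real. x \<ge> x1 \<Longrightarrow> u x \<ge> y0 \<and> ln x \<ge> max l0 100 \<and> ln (u x) - 1 \<ge> 24 \<and>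
      ln (u x) - 1 \<ge> ln (ln (ln x)) / 2 \<and> ln (ln (ln (ln x))) \<ge> 1 \<and> ln (ln (ln x)) \<ge> 1"
    unfolding eventually_at_top_linorder by blast
  define x0 where "x0 = max x1 (exp (exp (exp 1)) + 1)"
  have main: "1 / 4 * x * exp (- 24 * ln x * (ln (ln (ln (ln x))) / ln (ln (ln x))))
    \<le> real (card {n \<in> N_star. 1 \<le> real n \<and> real n \<le> x})" if "x \<ge> x0" for x
  proof -
    have X: "u x \<ge> y0" "ln x \<ge> l0" "ln x \<ge> 100" "ln (u x) - 1 \<ge> 24" "ln (u x) - 1 \<ge> ln (ln (ln x)) / 2"
      "ln (ln (ln (ln x))) \<ge> 1" "ln (ln (ln x)) \<ge> 1"
      using x1[of x] that unfolding x0_def by auto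
    have xpos: "x > 1"
    proof -
      have "exp (exp (exp 1)) > (0::real)" by simp
      then show ?thesis using that unfolding x0_def by linarith
    qed
    have ux: "u x \<ge> 16" using y0[OF X(1)] by simp
    have log_ge_ln: "log 2 y \<ge> ln y" if "y \<ge> 1" for y :: real
      using that ln_le_minus_one[of 2] by (simp add: log_def le_divide_eq mult_left_le)
    define L where "L = nat \<lfloor>log 2 x\<rfloor> + 1"
    have log2x: "log 2 x \<ge> 100" using log_ge_ln[of x] xpos X(3) by simp
    have L: "real L - 1 \<le> log 2 x" "log 2 x < real L" unfolding L_def using log2x by linarith+
    have Lln: "ln x \<le> real L" using log_ge_ln[of x] xpos L(2) by simp
    then have L100: "100 \<le> L" using X(3) by simp
    define B where "B = nat \<lfloor>log 2 (real L)\<rfloor>"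
    have logL: "log 2 (real L) \<ge> 0" using L100 by simp
    have B: "real B \<le> log 2 (real L)" "log 2 (real L) < real B + 1" unfolding B_def using logL by linarith+
    have B_ge: "ln (ln x) - 1 \<le> real B"
    proof -
      have "ln (ln x) \<le> ln (real L)" using Lln X(3) by simp
      also have "\<dots> \<le> log 2 (real L)" using L100 by (intro log_ge_ln) simp
      finally show ?thesis using B(2) by simp
    qed
    \<comment> \<open>With J + 1 = B div 8, M^8 = 2^(8 (J + 1)) is at most 2^B \<le> L. That the
      subtraction does not truncate follows from J \<ge> 16.\<close>
    define J where "J = B div 8 - 1"
    have uJ: "u x \<le> real J"
    proof -
      have "real B / 8 - 2 \<le> real J" unfolding J_def by linarith
      then show ?thesis using B_ge unfolding u_def by argo
    qed
    then have J16: "real J \<ge> 16" using ux by simp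
    have "16 \<le> J" using J16 by simp
    then have BJ: "8 * Suc J \<le> B" unfolding J_def by presburger
    define M :: nat where "M = 2 ^ Suc J"
    have M_le: "M ^ 8 \<le> L"
    proof -
      have "M ^ 8 = 2 ^ (Suc J * 8)" unfolding M_def by (rule power_mult[symmetric])
      also have "\<dots> \<le> 2 ^ B" using BJ by (intro power_increasing) auto
      finally have "real (M ^ 8) \<le> 2 powr real B" by (metis of_nat_mono of_nat_numeral of_nat_power powr_realpow zero_less_numeral)
      also have "\<dots> \<le> 2 powr (log 2 (real L))" using B(1) by (intro powr_mono) auto
      also have "\<dots> = real L" using L100 by simp
      finally show ?thesis by simp
    qed
    \<comment> \<open>J has the order of log M, so harm M / T is of order J / log J and still
      exceeds the loss 2 * harm J, of order log J, from the primes of Q.\<close>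
    define T where "T = nat \<lfloor>log 2 (real J)\<rfloor>"
    have logJ: "log 2 (real J) \<ge> 0" using J16 by simp
    have T: "real T \<le> log 2 (real J)" "log 2 (real J) < real T + 1" unfolding T_def using logJ by linarith+
    have T_ge: "ln (u x) - 1 \<le> real T"
    proof -
      have "ln (u x) \<le> ln (real J)" using uJ ux by simp
      also have "\<dots> \<le> log 2 (real J)" using J16 by (intro log_ge_ln) simp
      finally show ?thesis using T(2) by simp
    qed
    have T24: "24 \<le> T" using T_ge X(4) by linarith
    have T_le: "real T \<le> 2 * ln (real J)"
    proof -
      have "ln (real J) / ln 2 \<le> ln (real J) / (2 / 3)"
        using J16 ln2_ge_two_thirds by (intro divide_left_mono) auto
      moreover have "ln (real J) \<ge> 0" using J16 by simp
      ultimately show ?thesis using T(1) unfolding log_def by argo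
    qed
    have TM: "T \<le> M"
    proof -
      have "real J \<le> 2 ^ J" by (metis less_exp less_imp_le of_nat_le_iff of_nat_numeral of_nat_power)
      then have "log 2 (real J) \<le> log 2 (2 ^ J)" using J16 by (intro log_mono) auto
      then have "T \<le> J" using T(1) by (simp add: log_pow_cancel)
      also have "J \<le> 2 ^ J" by (simp add: less_imp_le less_exp)
      also have "\<dots> \<le> M" unfolding M_def by simp
      finally show ?thesis .
    qed
    have small: "960 * real T * exp ((2 - harm M / 4) / real T + (5 / 2 + 2 * harm J)) \<le> 1"
    proof -
      have "real M = 2 ^ Suc J" unfolding M_def by simp
      then have "ln (real M) = real (Suc J) * ln 2" using ln_realpow[of 2 "Suc J"] by simp
      moreover have "real (Suc J) * (2 / 3) \<le> real (Suc J) * ln 2"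
        by (intro mult_left_mono ln2_ge_two_thirds) auto
      ultimately have "real J / 2 \<le> ln (real M)" by simp
      also have "\<dots> \<le> ln (real M + 1)" by (rule ln_mono) (auto simp: M_def)
      also have "\<dots> \<le> harm M" by (rule harm_ge_ln)
      finally have hM: "2 - harm M / 4 \<le> 2 - real J / 8" by simp
      have "(2 - harm M / 4) / real T \<le> (2 - real J / 8) / real T"
        using hM by (intro divide_right_mono) auto
      also have "\<dots> \<le> (2 - real J / 8) / (2 * ln (real J))"
        using T_le T24 J16 by (intro divide_left_mono_neg) auto
      finally have 1: "(2 - harm M / 4) / real T \<le> (2 - real J / 8) / (2 * ln (real J))" .
      have 2: "harm J \<le> 1 + ln (real J)" using J16 by (intro harm_le_ln) simp
      have "960 * real T * exp ((2 - harm M / 4) / real T + (5 / 2 + 2 * harm J)) \<le>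
        1920 * ln (real J) * exp ((2 - real J / 8) / (2 * ln (real J)) + (5 / 2 + 2 * (1 + ln (real J))))"
      proof (rule mult_mono)
        show "960 * real T \<le> 1920 * ln (real J)" using T_le by simp
        show "exp ((2 - harm M / 4) / real T + (5 / 2 + 2 * harm J)) \<le>
          exp ((2 - real J / 8) / (2 * ln (real J)) + (5 / 2 + 2 * (1 + ln (real J))))"
          using 1 2 by simp
      qed (use J16 in auto)
      also have "\<dots> \<le> 1" using y0[of "real J"] X(1) uJ by simp
      finally show ?thesis .
    qed
    have bnd: "x / 4 * 2 powr (- (6 * real L / real T)) \<le> real (card {n \<in> N_star. 1 \<le> real n \<and> real n \<le> x})"
    proof (rule card_N_star_ge[of T J L x, folded M_def, OF T24 TM M_le L100 small])
      show "20 * real L ^ 4 * 2 powr (real L / 5) \<le> 2 powr (real L / 2)"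
        using X(2) Lln by (intro l0) simp
      show "2 powr (real L - 1) \<le> x" using L(1) xpos by (simp add: powr_le_iff)
      show "x < 2 powr real L" using L(2) xpos by (simp add: less_powr_iff)
    qed
    define t where "t = ln (ln (ln x))"
    have t: "t \<ge> 1" "ln t \<ge> 1" using X(6,7) unfolding t_def by auto
    have Tt: "t / 2 \<le> real T" using T_ge X(5) unfolding t_def by simp
    \<comment> \<open>24 = 6 * 2 * 2, with one factor 2 from L \<le> 2 log_2 x and one from T \<ge>
      t / 2. This yields ln x / t; the factor ln t \<ge> 1 is then inserted to reach the stated
      form.\<close>
    have "6 * real L / real T * ln 2 \<le> 24 * ln x * (ln t / t)"
    proof -
      have "real L \<le> 2 * log 2 x" using L(1) log2x by simp
      then have "real L * ln 2 \<le> 2 * log 2 x * ln 2" by (intro mult_right_mono) auto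
      also have "\<dots> = 2 * ln x" by (simp add: log_def)
      finally have "6 * (real L * ln 2) / real T \<le> 6 * (2 * ln x) / (t / 2)"
        using Tt t X(3) by (intro frac_le) auto
      also have "\<dots> = 24 * ln x * (1 / t)" by simp
      also have "\<dots> \<le> 24 * ln x * (ln t / t)"
        using t X(3) by (intro mult_left_mono divide_right_mono) auto
      finally show ?thesis by (simp add: mult_ac)
    qed
    then have "exp (- 24 * ln x * (ln t / t)) \<le> 2 powr (- (6 * real L / real T))"
      unfolding powr_def by simp
    then have "x / 4 * exp (- 24 * ln x * (ln t / t)) \<le> x / 4 * 2 powr (- (6 * real L / real T))"
      using xpos by (intro mult_left_mono) auto
    then show ?thesis using bnd unfolding t_def by simp
  qed
  have "x0 > exp (exp (exp 1))" unfolding x0_def by simp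
  then show ?thesis using main
    by (intro exI[of _ 24] exI[of _ "1 / 4"] exI[of _ x0]) auto
qed

end
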